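(* Let $k$ be an algebraically closed field, and let $\mathcal H_\alpha=\mathcal H_{n,q,N,\nu,\alpha}$ be the Hopf algebra over $k$ defined in the context. Then $\mathcal H_\alpha^*$ is pointed if and only if $\alpha=0$. Moreover, if $\alpha\ne0$ then $\mathcal H_\alpha^*$ contains an $n^2$-dimensional simple subcoalgebra.
   Context: $(b,c)$ denotes the greatest common divisor of integers $b,c$. A Hopf algebra is pointed if all its simple subcoalgebras are 1-dimensional. Let $n,\nu,N$ be positive integers with $n\mid N$, $1\le\nu<N$; let $q\in k$ be a primitive $n$th root of unity and $r=|q^\nu|$ the multiplicative order of $q^\nu$. For $\alpha=0$, $\mathcal H_0=\mathcal H_{n,q,N,\nu,0}=H_{n,q,N,\nu}$ is the Hopf algebra generated as an algebra by $a,x$ with relations $a^N=1$, $x^r=0$, $xa=qax$, and with $\Delta(a)=a\otimes a$, $\Delta(x)=x\otimes a^\nu+1\otimes x$, $\varepsilon(a)=1$, $\varepsilon(x)=0$, antipode $s(a)=a^{-1}$, $s(x)=-q^{-\nu}a^{-\nu}x$. For $0\ne\alpha\in k$ one further assumes $(n,\nu)=1$ (hence $r=n$), $n>1$ and $N\nmid\nu n$; then $\mathcal H_\alpha=\mathcal H_{n,q,N,\nu,\alpha}$ is generated as an algebra by $a,x$ with relations $a^N=1$, $x^n=\alpha(a^{\nu n}-1)$, $xa=qax$, with the same formulas for $\Delta,\varepsilon,s$ on $a,x$.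
   Formalization: For α≠0 and k of characteristic p>0, it is additionally assumed that N does not divide νn·p^j for any j≥0; otherwise x is nilpotent and the dual is pointed although α≠0 (e.g. p=3, n=2, q=-1, N=6, ν=1, α=1). *)

theory Defs
  imports
    "HOL-Algebra.Algebra"
    "HOL-Algebra.Algebraic_Closure_Type"
    "HOL-Library.Poly_Mapping"
begin

section \<open>Tensor products\<close>

text \<open>
  The ground field is a type \<open>'k\<close> of class \<open>field\<close>. Vector spaces and (not necessarily
  commutative) algebras over \<open>'k\<close> are carried by the library record \<open>module\<close>.

  \<open>V \<otimes> W\<close> is the free vector space on \<open>carrier V \<times> carrier W\<close> modulo the bilinearity relations;
  its elements are cosets of formal sums. Operations on cosets are unions over representatives,
  as for the library's \<open>rcoset_mult\<close>.
\<close>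

definition tensor_null ::
    "('k::field, 'v, 's) module_scheme \<Rightarrow> ('k, 'w, 't) module_scheme \<Rightarrow> ('v \<times> 'w \<Rightarrow>\<^sub>0 'k) set"
  where "tensor_null V W = Modules.module.span (\<lambda>c. Poly_Mapping.map ((*) c))
     ({Poly_Mapping.single (v \<oplus>\<^bsub>V\<^esub> v', w) 1 - Poly_Mapping.single (v, w) 1
         - Poly_Mapping.single (v', w) 1
         | v v' w. v \<in> carrier V \<and> v' \<in> carrier V \<and> w \<in> carrier W}
      \<union> {Poly_Mapping.single (v, w \<oplus>\<^bsub>W\<^esub> w') 1 - Poly_Mapping.single (v, w) 1
         - Poly_Mapping.single (v, w') 1
         | v w w'. v \<in> carrier V \<and> w \<in> carrier W \<and> w' \<in> carrier W}
      \<union> {Poly_Mapping.single (c \<odot>\<^bsub>V\<^esub> v, w) 1 - Poly_Mapping.single (v, w) c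
         | c v w. v \<in> carrier V \<and> w \<in> carrier W}
      \<union> {Poly_Mapping.single (v, c \<odot>\<^bsub>W\<^esub> w) 1 - Poly_Mapping.single (v, w) c
         | c v w. v \<in> carrier V \<and> w \<in> carrier W})"

definition tensor_class ::
    "('k::field, 'v, 's) module_scheme \<Rightarrow> ('k, 'w, 't) module_scheme
      \<Rightarrow> ('v \<times> 'w \<Rightarrow>\<^sub>0 'k) \<Rightarrow> ('v \<times> 'w \<Rightarrow>\<^sub>0 'k) set"
  where "tensor_class V W p = (+) p ` tensor_null V W"

abbreviation pure_tensor ::
    "('k::field, 'v, 's) module_scheme \<Rightarrow> ('k, 'w, 't) module_scheme
      \<Rightarrow> 'v \<Rightarrow> 'w \<Rightarrow> ('v \<times> 'w \<Rightarrow>\<^sub>0 'k) set"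
  where "pure_tensor V W v w \<equiv> tensor_class V W (Poly_Mapping.single (v, w) 1)"

definition tensor ::
    "('k::field, 'v, 's) module_scheme \<Rightarrow> ('k, 'w, 't) module_scheme
      \<Rightarrow> ('k, ('v \<times> 'w \<Rightarrow>\<^sub>0 'k) set) module"
  where "tensor V W =
    \<lparr>carrier = tensor_class V W ` {p. Poly_Mapping.keys p \<subseteq> carrier V \<times> carrier W},
     monoid.mult = (\<lambda>P Q. \<Union>p\<in>P. \<Union>q\<in>Q. tensor_class V W
        (\<Sum>s\<in>Poly_Mapping.keys p. \<Sum>t\<in>Poly_Mapping.keys q.
          Poly_Mapping.single (fst s \<otimes>\<^bsub>V\<^esub> fst t, snd s \<otimes>\<^bsub>W\<^esub> snd t)
            (Poly_Mapping.lookup p s * Poly_Mapping.lookup q t))),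
     one = pure_tensor V W \<one>\<^bsub>V\<^esub> \<one>\<^bsub>W\<^esub>,
     ring.zero = tensor_null V W,
     add = (\<lambda>P Q. \<Union>p\<in>P. \<Union>q\<in>Q. tensor_class V W (p + q)),
     module.smult = (\<lambda>c P. \<Union>p\<in>P. tensor_class V W (Poly_Mapping.map ((*) c) p))\<rparr>"


section \<open>Subcoalgebras and pointedness\<close>

record (overloaded) ('k, 'h) hopf = "('k::zero, 'h) module" +
  comult :: "'h \<Rightarrow> ('h \<times> 'h \<Rightarrow>\<^sub>0 'k) set"
  counit :: "'h \<Rightarrow> 'k"
  antipode :: "'h \<Rightarrow> 'h"

text \<open>
  The condition is \<open>\<Delta>(C) \<subseteq> C \<otimes> C\<close>, where \<open>C \<otimes> C\<close> stands for its (isomorphic) image in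
  \<open>D \<otimes> D\<close>.
\<close>

definition subcoalgebra :: "('k::field, 'h, 's) hopf_scheme \<Rightarrow> 'h set \<Rightarrow> bool"
  where "subcoalgebra D C \<longleftrightarrow>
    submodule C (ring_of_type_algebra :: 'k ring) D \<and>
    comult D ` C \<subseteq> tensor_class D D ` {p. Poly_Mapping.keys p \<subseteq> C \<times> C}"

definition simple_subcoalgebra :: "('k::field, 'h, 's) hopf_scheme \<Rightarrow> 'h set \<Rightarrow> bool"
  where "simple_subcoalgebra D C \<longleftrightarrow>
    subcoalgebra D C \<and> C \<noteq> {\<zero>\<^bsub>D\<^esub>} \<and>
    (\<forall>E. subcoalgebra D E \<and> E \<subseteq> C \<longrightarrow> E = {\<zero>\<^bsub>D\<^esub>} \<or> E = C)"

definition has_dimension :: "('k, 'v, 's) module_scheme \<Rightarrow> 'v set \<Rightarrow> nat \<Rightarrow> bool"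
  where "has_dimension V C d \<longleftrightarrow>
    (\<exists>B. B \<subseteq> C \<and> finite B \<and> card B = d \<and>
      (\<forall>v\<in>C. \<exists>!c. c \<in> B \<rightarrow>\<^sub>E (UNIV :: 'k set) \<and> v = (\<Oplus>\<^bsub>V\<^esub>b\<in>B. c b \<odot>\<^bsub>V\<^esub> b)))"

definition pointed :: "('k::field, 'h, 's) hopf_scheme \<Rightarrow> bool"
  where "pointed D \<longleftrightarrow> (\<forall>C. simple_subcoalgebra D C \<longrightarrow> has_dimension D C 1)"


section \<open>The dual of a finite-dimensional Hopf algebra\<close>

definition dual_carrier :: "('k::field, 'h, 's) module_scheme \<Rightarrow> ('h \<Rightarrow> 'k) set"
  where "dual_carrier H = {f \<in> extensional (carrier H).
    (\<forall>u\<in>carrier H. \<forall>v\<in>carrier H. f (u \<oplus>\<^bsub>H\<^esub> v) = f u + f v) \<and>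
    (\<forall>c. \<forall>u\<in>carrier H. f (c \<odot>\<^bsub>H\<^esub> u) = c * f u)}"

text \<open>
  The comultiplication of \<open>H\<^sup>*\<close> is the transpose of the multiplication of \<open>H\<close>, under
  \<open>H\<^sup>* \<otimes> H\<^sup>* \<cong> (H \<otimes> H)\<^sup>*\<close>: it sends \<open>f\<close> to the class of the formal sums \<open>\<Sum> c (g, h)\<close> over
  \<open>H\<^sup>* \<times> H\<^sup>*\<close> with \<open>f (u v) = \<Sum> c g(u) h(v)\<close>. Since \<open>H\<^sup>* \<otimes> H\<^sup>* \<rightarrow> (H \<otimes> H)\<^sup>*\<close> is injective, the set
  of these formal sums is a single coset of \<open>tensor_null\<close> (nonempty for finite-dimensional \<open>H\<close>),
  that is, an element of \<open>H\<^sup>* \<otimes> H\<^sup>*\<close>. The product of \<open>H\<^sup>*\<close> is the convolution.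
\<close>

definition dual_hopf :: "('k::field, 'h, 's) hopf_scheme \<Rightarrow> ('k, 'h \<Rightarrow> 'k) hopf"
  where "dual_hopf H =
    \<lparr>carrier = dual_carrier H,
     monoid.mult = (\<lambda>f g. \<lambda>u\<in>carrier H. the_elem
        ((\<lambda>p. \<Sum>s\<in>Poly_Mapping.keys p. Poly_Mapping.lookup p s * f (fst s) * g (snd s))
           ` comult H u)),
     one = (\<lambda>u\<in>carrier H. counit H u),
     ring.zero = (\<lambda>u\<in>carrier H. 0),
     add = (\<lambda>f g. \<lambda>u\<in>carrier H. f u + g u),
     module.smult = (\<lambda>c f. \<lambda>u\<in>carrier H. c * f u),
     comult = (\<lambda>f. {p. Poly_Mapping.keys p \<subseteq> dual_carrier H \<times> dual_carrier H \<and>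
        (\<forall>u\<in>carrier H. \<forall>v\<in>carrier H. f (u \<otimes>\<^bsub>H\<^esub> v) =
          (\<Sum>s\<in>Poly_Mapping.keys p. Poly_Mapping.lookup p s * fst s u * snd s v))}),
     counit = (\<lambda>f. f \<one>\<^bsub>H\<^esub>),
     antipode = (\<lambda>f. \<lambda>u\<in>carrier H. f (antipode H u))\<rparr>"


section \<open>The free algebra on two generators\<close>

datatype gen = Gen_a | Gen_x

datatype word = Word (letters: "gen list")

instantiation word :: monoid_add
begin

definition zero_word :: word where "0 = Word []"

definition plus_word :: "word \<Rightarrow> word \<Rightarrow> word" where "u + v = Word (letters u @ letters v)"

instance by standard (simp_all add: zero_word_def plus_word_def)

end

text \<open>
  With this instance the library's convolution product makes \<open>word \<Rightarrow>\<^sub>0 'k\<close> the free algebra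
  \<open>k\<langle>a,x\<rangle>\<close>.
\<close>

type_synonym 'k free_alg = "word \<Rightarrow>\<^sub>0 'k"

abbreviation scal :: "'k::field \<Rightarrow> 'k free_alg"
  where "scal c \<equiv> Poly_Mapping.single 0 c"

abbreviation gen_a :: "'k::field free_alg"
  where "gen_a \<equiv> Poly_Mapping.single (Word [Gen_a]) 1"

abbreviation gen_x :: "'k::field free_alg"
  where "gen_x \<equiv> Poly_Mapping.single (Word [Gen_x]) 1"

text \<open>
  The algebra map from the free algebra to \<open>B\<close> with given values \<open>g\<close> on the generators.
\<close>

definition eval_alg :: "('k::field, 'b, 's) module_scheme \<Rightarrow> (gen \<Rightarrow> 'b) \<Rightarrow> 'k free_alg \<Rightarrow> 'b"
  where "eval_alg B g p = (\<Oplus>\<^bsub>B\<^esub>w\<in>Poly_Mapping.keys p.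
    Poly_Mapping.lookup p w \<odot>\<^bsub>B\<^esub> foldr (\<lambda>l b. g l \<otimes>\<^bsub>B\<^esub> b) (letters w) \<one>\<^bsub>B\<^esub>)"

definition opposite :: "('k, 'b, 's) module_scheme \<Rightarrow> ('k, 'b, 's) module_scheme"
  where "opposite B = B\<lparr>monoid.mult := (\<lambda>u v. v \<otimes>\<^bsub>B\<^esub> u)\<rparr>"

definition base_alg :: "('k::field, 'k) module"
  where "base_alg = ring.extend ring_of_type_algebra \<lparr>module.smult = (*)\<rparr>"


section \<open>The Hopf algebras in question\<close>

definition primitive_root_of_unity :: "nat \<Rightarrow> 'k::field \<Rightarrow> bool"
  where "primitive_root_of_unity n q \<longleftrightarrow>
    n > 0 \<and> q ^ n = 1 \<and> (\<forall>m. 0 < m \<and> m < n \<longrightarrow> q ^ m \<noteq> 1)"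

definition mult_order :: "'k::field \<Rightarrow> nat"
  where "mult_order z = (LEAST m. m > 0 \<and> z ^ m = 1)"

text \<open>
  The relators are \<open>a\<^sup>N - 1\<close>, \<open>xa - qax\<close>, and \<open>x\<^sup>r\<close> with \<open>r = |q\<^sup>\<nu>|\<close> if \<open>\<alpha> = 0\<close>,
  \<open>x\<^sup>n - \<alpha>(a\<^sup>\<nu>\<^sup>n - 1)\<close> if \<open>\<alpha> \<noteq> 0\<close>.
\<close>

definition H_relations :: "nat \<Rightarrow> 'k::field \<Rightarrow> nat \<Rightarrow> nat \<Rightarrow> 'k \<Rightarrow> 'k free_alg set"
  where "H_relations n q N \<nu> \<alpha> =
    {gen_a ^ N - 1,
     if \<alpha> = 0 then gen_x ^ mult_order (q ^ \<nu>)
     else gen_x ^ n - scal \<alpha> * (gen_a ^ (\<nu> * n) - 1),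
     gen_x * gen_a - scal q * gen_a * gen_x}"

definition H_ideal :: "nat \<Rightarrow> 'k::field \<Rightarrow> nat \<Rightarrow> nat \<Rightarrow> 'k \<Rightarrow> 'k free_alg set"
  where "H_ideal n q N \<nu> \<alpha> = Idl\<^bsub>ring_of_type_algebra\<^esub> (H_relations n q N \<nu> \<alpha>)"

definition H_class ::
    "nat \<Rightarrow> 'k::field \<Rightarrow> nat \<Rightarrow> nat \<Rightarrow> 'k \<Rightarrow> 'k free_alg \<Rightarrow> 'k free_alg set"
  where "H_class n q N \<nu> \<alpha> p = H_ideal n q N \<nu> \<alpha> +>\<^bsub>ring_of_type_algebra\<^esub> p"

definition H_alg :: "nat \<Rightarrow> 'k::field \<Rightarrow> nat \<Rightarrow> nat \<Rightarrow> 'k \<Rightarrow> ('k, 'k free_alg set) module"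
  where "H_alg n q N \<nu> \<alpha> =
    (let Q = ring_of_type_algebra Quot (H_ideal n q N \<nu> \<alpha>)
     in ring.extend Q \<lparr>module.smult = (\<lambda>c u. H_class n q N \<nu> \<alpha> (scal c) \<otimes>\<^bsub>Q\<^esub> u)\<rparr>)"

text \<open>
  \<open>\<Delta>\<close> and \<open>\<epsilon>\<close> are the algebra maps, and \<open>s\<close> is the algebra antihomomorphism, with the prescribed
  values on \<open>a\<close> and \<open>x\<close>. Each is induced by the corresponding map on the free algebra, which is
  constant on the classes modulo the ideal of relations, whence \<open>the_elem\<close> of the image of a class.
\<close>

definition H_hopf :: "nat \<Rightarrow> 'k::field \<Rightarrow> nat \<Rightarrow> nat \<Rightarrow> 'k \<Rightarrow> ('k, 'k free_alg set) hopf"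
  where "H_hopf n q N \<nu> \<alpha> =
    (let H = H_alg n q N \<nu> \<alpha>;
         HH = tensor H H;
         a = H_class n q N \<nu> \<alpha> gen_a;
         x = H_class n q N \<nu> \<alpha> gen_x;
         D = (\<lambda>l. case l of
                Gen_a \<Rightarrow> pure_tensor H H a a
              | Gen_x \<Rightarrow> pure_tensor H H x (a [^]\<^bsub>H\<^esub> \<nu>) \<oplus>\<^bsub>HH\<^esub> pure_tensor H H \<one>\<^bsub>H\<^esub> x);
         e = (\<lambda>l. case l of Gen_a \<Rightarrow> 1 | Gen_x \<Rightarrow> 0);
         s = (\<lambda>l. case l of
                Gen_a \<Rightarrow> inv\<^bsub>H\<^esub> a
              | Gen_x \<Rightarrow> (- inverse (q ^ \<nu>)) \<odot>\<^bsub>H\<^esub> ((inv\<^bsub>H\<^esub> a) [^]\<^bsub>H\<^esub> \<nu> \<otimes>\<^bsub>H\<^esub> x))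
     in module.extend H
       \<lparr>comult = (\<lambda>u. the_elem (eval_alg HH D ` u)),
        counit = (\<lambda>u. the_elem (eval_alg base_alg e ` u)),
        antipode = (\<lambda>u. the_elem (eval_alg (opposite H) s ` u))\<rparr>)"

end

theory Submission
  imports Defs
begin

text \<open>
  Subcoalgebras of \<open>H\<^sup>*\<close> are subspaces stable under both translations \<open>f \<mapsto> f(u \<cdot>)\<close> and
  \<open>f \<mapsto> f(\<cdot> u)\<close>, so only the algebra \<open>H\<close> matters. If \<open>\<alpha> = 0\<close>, translation by \<open>x\<close> is nilpotent
  and translation by \<open>a\<close> has finite order; hence every nonzero subcoalgebra contains an \<open>f\<close> with
  \<open>f(u x) = 0\<close> and \<open>f(u a) = \<mu> f(u)\<close>, which is a multiple of a character and spans a subcoalgebra.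
  If \<open>\<alpha> \<noteq> 0\<close>, choose \<open>l\<close> with \<open>l\<^sup>N = 1\<close>, \<open>l\<^sup>\<nu>\<^sup>n \<noteq> 1\<close>. Then \<open>H\<close> acts on \<open>k\<^sup>n\<close> with \<open>a\<close> diagonal with
  the distinct eigenvalues \<open>l q\<^sup>i\<close> and \<open>x\<close> an invertible cyclic shift. Thus \<open>H\<close> maps onto the full
  matrix algebra, and the matrix coefficients span a simple subcoalgebra of dimension \<open>n\<^sup>2\<close>.
\<close>

section \<open>Linear extension of functions on a basis\<close>

definition lin_ext :: "('a \<Rightarrow> 'k::field) \<Rightarrow> ('a \<Rightarrow>\<^sub>0 'k) \<Rightarrow> 'k"
  where "lin_ext F p = (\<Sum>s\<in>Poly_Mapping.keys p. Poly_Mapping.lookup p s * F s)"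

text \<open>Cancellation can shrink supports, so additivity of \<open>lin_ext\<close> is checked by
  summing over a common larger set.\<close>

lemma lin_ext_superset:
  assumes "finite A" "Poly_Mapping.keys p \<subseteq> A"
  shows "lin_ext F p = (\<Sum>s\<in>A. Poly_Mapping.lookup p s * F s)"
  unfolding lin_ext_def
  by (rule sum.mono_neutral_left) (use assms in \<open>auto simp: in_keys_iff\<close>)

lemma lin_ext_zero [simp]: "lin_ext F 0 = 0"
  by (simp add: lin_ext_def)

lemma lin_ext_single [simp]: "lin_ext F (Poly_Mapping.single s c) = c * F s"
  by (simp add: lin_ext_def)

lemma lin_ext_add: "lin_ext F (p + p') = lin_ext F p + lin_ext F p'"
proof -
  let ?A = "Poly_Mapping.keys p \<union> Poly_Mapping.keys p'"
  have "lin_ext F (p + p') = (\<Sum>s\<in>?A. Poly_Mapping.lookup (p + p') s * F s)"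
    by (rule lin_ext_superset) (auto dest: subsetD[OF Poly_Mapping.keys_add])
  also have "\<dots> = lin_ext F p + lin_ext F p'"
    by (simp add: lookup_add distrib_right sum.distrib
        lin_ext_superset[of ?A p] lin_ext_superset[of ?A p'])
  finally show ?thesis .
qed

lemma lin_ext_sum: "lin_ext F (sum f A) = (\<Sum>i\<in>A. lin_ext F (f i))"
  by (induction A rule: infinite_finite_induct) (simp_all add: lin_ext_add)

lemma poly_mapping_sum_singles:
  "p = (\<Sum>s\<in>Poly_Mapping.keys p. Poly_Mapping.single s (Poly_Mapping.lookup p s))"
  by (rule poly_mapping_eqI)
    (auto simp: lookup_sum lookup_single when_def in_keys_iff if_distrib sum.delta' cong: if_cong)

text \<open>For claims additive in a formal sum. Monomials with arbitrary coefficient form the base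
  case, so scaling needs no separate step.\<close>

lemma poly_mapping_linear_induct [case_names single add]:
  assumes single: "\<And>s c. P (Poly_Mapping.single s c)"
    and add: "\<And>p p'. P p \<Longrightarrow> P p' \<Longrightarrow> P (p + p')"
  shows "P (p :: 'a \<Rightarrow>\<^sub>0 'k::comm_monoid_add)"
proof -
  have "P (\<Sum>s\<in>A. Poly_Mapping.single s (f s))" if "finite A" for A and f :: "'a \<Rightarrow> 'k"
    using that
  proof (induction A)
    case empty
    \<comment> \<open>The empty sum \<open>0\<close> is a monomial with coefficient
      \<open>0\<close>, at an arbitrary key.\<close>
    then show ?case using single[of undefined 0] by simp
  next
    case (insert s A)
    then show ?case using single add by simp
  qed
  then show ?thesis
    by (subst poly_mapping_sum_singles) simp
qed

lemma lin_ext_scale: "lin_ext F (Poly_Mapping.map ((*) c) p) = c * lin_ext F p"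
proof -
  have "lin_ext F (Poly_Mapping.map ((*) c) p)
      = (\<Sum>s\<in>Poly_Mapping.keys p. Poly_Mapping.lookup (Poly_Mapping.map ((*) c) p) s * F s)"
    by (rule lin_ext_superset) (auto simp: in_keys_iff map.rep_eq when_def)
  then show ?thesis
    by (simp add: lin_ext_def sum_distrib_left map.rep_eq when_def mult.assoc in_keys_iff)
qed

lemma lin_ext_diff: "lin_ext F (p - p') = lin_ext F p - lin_ext F p'"
proof -
  have "lin_ext F p = lin_ext F (p - p') + lin_ext F p'"
    by (simp flip: lin_ext_add)
  then show ?thesis by simp
qed

lemma lookup_scale:
  "Poly_Mapping.lookup (Poly_Mapping.map ((*) c) p) s = (c::'k::field) * Poly_Mapping.lookup p s"
  by (simp add: map.rep_eq when_def)

text \<open>Opens the library theory of spans and subspaces, in which \<open>tensor_null\<close> is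
  phrased.\<close>

lemma poly_mapping_module:
  "Modules.module (\<lambda>c::'k::field. Poly_Mapping.map ((*) c) :: ('a \<Rightarrow>\<^sub>0 'k) \<Rightarrow> _)"
proof
  fix a b :: 'k and x y :: "'a \<Rightarrow>\<^sub>0 'k"
  show "Poly_Mapping.map ((*) a) (x + y)
      = Poly_Mapping.map ((*) a) x + Poly_Mapping.map ((*) a) y"
    by (rule poly_mapping_eqI) (simp add: lookup_scale lookup_add distrib_left)
  show "Poly_Mapping.map ((*) (a + b)) x
      = Poly_Mapping.map ((*) a) x + Poly_Mapping.map ((*) b) x"
    by (rule poly_mapping_eqI) (simp add: lookup_scale lookup_add distrib_right)
  show "Poly_Mapping.map ((*) a) (Poly_Mapping.map ((*) b) x) = Poly_Mapping.map ((*) (a * b)) x"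
    by (rule poly_mapping_eqI) (simp add: lookup_scale)
  show "Poly_Mapping.map ((*) 1) x = x"
    by (rule poly_mapping_eqI) (simp add: lookup_scale)
qed

section \<open>The linear structure of the dual\<close>

lemma dual_hopf_simps [simp]:
  "carrier (dual_hopf H) = dual_carrier H"
  "ring.zero (dual_hopf H) = (\<lambda>u\<in>carrier H. 0)"
  "ring.add (dual_hopf H) f g = (\<lambda>u\<in>carrier H. f u + g u)"
  "module.smult (dual_hopf H) c f = (\<lambda>u\<in>carrier H. c * f u)"
  by (simp_all add: dual_hopf_def)

lemma dual_carrier_eqI:
  assumes "f \<in> dual_carrier H" "g \<in> dual_carrier H" "\<And>u. u \<in> carrier H \<Longrightarrow> f u = g u"
  shows "f = g"
  using assms by (auto simp: dual_carrier_def intro: extensionalityI)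

locale algebra_over_field =
  fixes H :: "('k::field, 'h, 's) hopf_scheme" (structure)
  assumes ring_H: "ring H"
    and smult_closed: "u \<in> carrier H \<Longrightarrow> c \<odot> u \<in> carrier H"
    and smult_mult_left: "\<lbrakk>u \<in> carrier H; v \<in> carrier H\<rbrakk> \<Longrightarrow> (c \<odot> u) \<otimes> v = c \<odot> (u \<otimes> v)"
    and smult_mult_right: "\<lbrakk>u \<in> carrier H; v \<in> carrier H\<rbrakk> \<Longrightarrow> u \<otimes> (c \<odot> v) = c \<odot> (u \<otimes> v)"
begin

sublocale ring H by (rule ring_H)

abbreviation dual :: "('k, 'h \<Rightarrow> 'k) hopf" where "dual \<equiv> dual_hopf H"

lemma dual_add: "\<lbrakk>f \<in> dual_carrier H; u \<in> carrier H; v \<in> carrier H\<rbrakk> \<Longrightarrow> f (u \<oplus> v) = f u + f v"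
  and dual_smult: "\<lbrakk>f \<in> dual_carrier H; u \<in> carrier H\<rbrakk> \<Longrightarrow> f (c \<odot> u) = c * f u"
  by (auto simp: dual_carrier_def)

lemma dual_carrier_zero: "(\<lambda>u\<in>carrier H. 0) \<in> dual_carrier H"
  and dual_carrier_add: "\<lbrakk>f \<in> dual_carrier H; g \<in> dual_carrier H\<rbrakk>
    \<Longrightarrow> (\<lambda>u\<in>carrier H. f u + g u) \<in> dual_carrier H"
  and dual_carrier_smult: "f \<in> dual_carrier H \<Longrightarrow> (\<lambda>u\<in>carrier H. c * f u) \<in> dual_carrier H"
  by (auto simp: dual_carrier_def smult_closed algebra_simps)

lemma dual_abelian_group: "abelian_group dual"
proof (rule abelian_groupI, goal_cases)
  \<comment> \<open>This case is the existence of additive inverses, obtained as multiples by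
    \<open>- 1\<close>.\<close>
  case (6 f)
  show ?case
    by (rule bexI[of _ "\<lambda>u\<in>carrier H. - 1 * f u"])
      (use 6 dual_carrier_smult[of f "- 1"] in \<open>auto simp: restrict_def\<close>)
qed (auto simp: dual_carrier_def extensional_def fun_eq_iff restrict_def algebra_simps smult_closed)

lemma dual_finsum:
  assumes "finite I" "g \<in> I \<rightarrow> dual_carrier H"
  shows "(\<Oplus>\<^bsub>dual\<^esub>i\<in>I. g i) = (\<lambda>u\<in>carrier H. \<Sum>i\<in>I. g i u)"
  using assms
proof (induction I)
  case empty
  then show ?case
    by (subst abelian_monoid.finsum_empty[OF abelian_group.axioms(1)[OF dual_abelian_group]])
      (simp add: restrict_def)
next
  case (insert i I)
  have "(\<Oplus>\<^bsub>dual\<^esub>i\<in>insert i I. g i) = g i \<oplus>\<^bsub>dual\<^esub> (\<Oplus>\<^bsub>dual\<^esub>i\<in>I. g i)"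
    by (rule abelian_monoid.finsum_insert[OF abelian_group.axioms(1)[OF dual_abelian_group]])
      (use insert in auto)
  then show ?case using insert by (auto simp: restrict_def)
qed

definition dual_subspace :: "('h \<Rightarrow> 'k) set \<Rightarrow> bool"
  where "dual_subspace C \<longleftrightarrow> C \<subseteq> dual_carrier H \<and> (\<lambda>u\<in>carrier H. 0) \<in> C \<and>
    (\<forall>f\<in>C. \<forall>g\<in>C. (\<lambda>u\<in>carrier H. f u + g u) \<in> C) \<and> (\<forall>c. \<forall>f\<in>C. (\<lambda>u\<in>carrier H. c * f u) \<in> C)"

text \<open>The additive inverses that \<open>submodule\<close> asks for are multiples by
  \<open>- 1\<close>, so closure under sums and scaling suffices.\<close>

lemma submodule_dual_iff:
  "submodule C (ring_of_type_algebra :: 'k ring) dual \<longleftrightarrow> dual_subspace C"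
proof
  assume "submodule C (ring_of_type_algebra :: 'k ring) dual"
  then interpret submodule C "ring_of_type_algebra :: 'k ring" dual .
  show "dual_subspace C"
    using subset one_closed m_closed smult_closed
    by (auto simp: dual_subspace_def ring_of_type_algebra_def)
next
  assume C: "dual_subspace C"
  interpret D: abelian_group dual by (rule dual_abelian_group)
  have inv: "inv\<^bsub>add_monoid dual\<^esub> f = (\<lambda>u\<in>carrier H. - 1 * f u)" if "f \<in> C" for f
  proof -
    have f: "f \<in> dual_carrier H" using C that by (auto simp: dual_subspace_def)
    have "\<ominus>\<^bsub>dual\<^esub> f = (\<lambda>u\<in>carrier H. - 1 * f u)"
      by (rule D.minus_equality) (use f dual_carrier_smult[OF f, of "- 1"] in \<open>auto simp: restrict_def\<close>)
    then show ?thesis by (simp add: a_inv_def)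
  qed
  show "submodule C (ring_of_type_algebra :: 'k ring) dual"
  proof (intro submodule.intro subgroup.intro submodule_axioms.intro)
    fix f assume "f \<in> C"
    then show "inv\<^bsub>add_monoid dual\<^esub> f \<in> C"
      using C unfolding inv[OF \<open>f \<in> C\<close>] dual_subspace_def by blast
  qed (use C in \<open>auto simp: dual_subspace_def\<close>)
qed

lemma dual_subspace_sum:
  assumes "dual_subspace C" "\<And>i. i \<in> I \<Longrightarrow> g i \<in> C"
  shows "(\<lambda>u\<in>carrier H. \<Sum>i\<in>I. c i * g i u) \<in> C"
  using assms(2)
proof (induction I rule: infinite_finite_induct)
  case (insert i I)
  have "(\<lambda>u\<in>carrier H. c i * g i u) \<in> C" "(\<lambda>u\<in>carrier H. \<Sum>i\<in>I. c i * g i u) \<in> C"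
    using assms(1) insert unfolding dual_subspace_def by blast+
  then have "(\<lambda>u\<in>carrier H. (\<lambda>u\<in>carrier H. c i * g i u) u
      + (\<lambda>u\<in>carrier H. \<Sum>i\<in>I. c i * g i u) u) \<in> C"
    using assms(1) unfolding dual_subspace_def by blast
  also have "?this \<longleftrightarrow> ?case"
    by (intro arg_cong[where f = "\<lambda>f. f \<in> C"] restrict_ext) (use insert in simp)
  finally show ?case .
qed (use assms(1) in \<open>auto simp: dual_subspace_def\<close>)

lemma dual_subspace_dual_carrier: "dual_subspace (dual_carrier H)"
  by (auto simp: dual_subspace_def dual_carrier_zero dual_carrier_add dual_carrier_smult)

end

section \<open>Subcoalgebras of the dual\<close>

context algebra_over_field
begin

abbreviation dual_null :: "(('h \<Rightarrow> 'k) \<times> ('h \<Rightarrow> 'k) \<Rightarrow>\<^sub>0 'k) set"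
  where "dual_null \<equiv> tensor_null dual dual"

text \<open>The canonical map from formal sums to bilinear forms on \<open>H\<close>, evaluated at
  \<open>(u, v)\<close>. On sums supported in the dual its common kernel is
  \<open>dual_null\<close>.\<close>

definition pairing :: "'h \<Rightarrow> 'h \<Rightarrow> (('h \<Rightarrow> 'k) \<times> ('h \<Rightarrow> 'k) \<Rightarrow>\<^sub>0 'k) \<Rightarrow> 'k"
  where "pairing u v = lin_ext (\<lambda>s. fst s u * snd s v)"

interpretation pm: Modules.module
  "\<lambda>c::'k. Poly_Mapping.map ((*) c) :: (('h \<Rightarrow> 'k) \<times> ('h \<Rightarrow> 'k) \<Rightarrow>\<^sub>0 'k) \<Rightarrow> _"
  by (rule poly_mapping_module)

lemma comult_dual:
  "comult dual f = {p. Poly_Mapping.keys p \<subseteq> dual_carrier H \<times> dual_carrier H \<and>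
    (\<forall>u\<in>carrier H. \<forall>v\<in>carrier H. f (u \<otimes> v) = pairing u v p)}"
  by (simp add: dual_hopf_def pairing_def lin_ext_def mult.assoc)

lemma dual_null_add:
  assumes "f \<in> dual_carrier H" "f' \<in> dual_carrier H" "g \<in> dual_carrier H"
  shows "Poly_Mapping.single (\<lambda>u\<in>carrier H. f u + f' u, g) 1 - Poly_Mapping.single (f, g) 1
      - Poly_Mapping.single (f', g) 1 \<in> dual_null"
    and "Poly_Mapping.single (g, \<lambda>u\<in>carrier H. f u + f' u) 1 - Poly_Mapping.single (g, f) 1
      - Poly_Mapping.single (g, f') 1 \<in> dual_null"
  unfolding tensor_null_def dual_hopf_simps by (rule pm.span_base; use assms in blast)+

lemma dual_null_smult:
  assumes "f \<in> dual_carrier H" "g \<in> dual_carrier H"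
  shows "Poly_Mapping.single (\<lambda>u\<in>carrier H. c * f u, g) 1 - Poly_Mapping.single (f, g) c \<in> dual_null"
    and "Poly_Mapping.single (g, \<lambda>u\<in>carrier H. c * f u) 1 - Poly_Mapping.single (g, f) c \<in> dual_null"
  unfolding tensor_null_def dual_hopf_simps by (rule pm.span_base; use assms in blast)+

lemma dual_null_subspace: "pm.subspace dual_null"
  unfolding tensor_null_def by (rule pm.subspace_span)

lemmas dual_null_closed = pm.subspace_0[OF dual_null_subspace]
  pm.subspace_add[OF dual_null_subspace] pm.subspace_diff[OF dual_null_subspace]
  pm.subspace_sum[OF dual_null_subspace] pm.subspace_scale[OF dual_null_subspace]

text \<open>The formal sums over the dual with zero pairing form a subspace, and this subspace
  contains all four families of bilinearity relators.\<close>

lemma dual_null_vanishes: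
  assumes "p \<in> dual_null"
  shows "Poly_Mapping.keys p \<subseteq> dual_carrier H \<times> dual_carrier H \<and>
    (\<forall>u\<in>carrier H. \<forall>v\<in>carrier H. pairing u v p = 0)"
proof -
  let ?S = "{p. Poly_Mapping.keys p \<subseteq> dual_carrier H \<times> dual_carrier H \<and>
    (\<forall>u\<in>carrier H. \<forall>v\<in>carrier H. pairing u v p = 0)}"
  have "pm.subspace ?S"
  proof (rule pm.subspaceI)
    fix p p' :: "('h \<Rightarrow> 'k) \<times> ('h \<Rightarrow> 'k) \<Rightarrow>\<^sub>0 'k"
    assume "p \<in> ?S" "p' \<in> ?S"
    then show "p + p' \<in> ?S"
      using Poly_Mapping.keys_add[of p p'] by (auto simp: pairing_def lin_ext_add)
  next
    fix p :: "('h \<Rightarrow> 'k) \<times> ('h \<Rightarrow> 'k) \<Rightarrow>\<^sub>0 'k" and c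
    assume "p \<in> ?S"
    then show "Poly_Mapping.map ((*) c) p \<in> ?S"
      by (auto simp: pairing_def lin_ext_scale in_keys_iff lookup_scale subset_iff)
  qed (simp add: pairing_def)
  moreover
  have "{Poly_Mapping.single (v \<oplus>\<^bsub>dual\<^esub> v', w) 1 - Poly_Mapping.single (v, w) 1
         - Poly_Mapping.single (v', w) 1
         | v v' w. v \<in> carrier dual \<and> v' \<in> carrier dual \<and> w \<in> carrier dual}
      \<union> {Poly_Mapping.single (v, w \<oplus>\<^bsub>dual\<^esub> w') 1 - Poly_Mapping.single (v, w) 1
         - Poly_Mapping.single (v, w') 1
         | v w w'. v \<in> carrier dual \<and> w \<in> carrier dual \<and> w' \<in> carrier dual}
      \<union> {Poly_Mapping.single (c \<odot>\<^bsub>dual\<^esub> v, w) 1 - Poly_Mapping.single (v, w) c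
         | c v w. v \<in> carrier dual \<and> w \<in> carrier dual}
      \<union> {Poly_Mapping.single (v, c \<odot>\<^bsub>dual\<^esub> w) 1 - Poly_Mapping.single (v, w) c
         | c v w. v \<in> carrier dual \<and> w \<in> carrier dual} \<subseteq> ?S"
    by (auto simp: pairing_def lin_ext_diff distrib_left distrib_right mult.assoc mult.left_commute dual_carrier_add dual_carrier_smult
        dest!: subsetD[OF keys_diff] split: if_splits)
  ultimately show ?thesis
    using assms pm.span_minimal unfolding tensor_null_def by blast
qed

lemma dual_null_single_zero:
  assumes "g \<in> dual_carrier H"
  shows "Poly_Mapping.single (g, \<lambda>u\<in>carrier H. 0) 1 \<in> dual_null"
  using dual_null_smult(2)[of g g 0] assms by simp

lemma dual_null_sum_left:
  assumes "finite I" "\<And>i. i \<in> I \<Longrightarrow> g i \<in> dual_carrier H" "h \<in> dual_carrier H"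
  shows "Poly_Mapping.single (\<lambda>u\<in>carrier H. \<Sum>i\<in>I. c i * g i u, h) 1
    - (\<Sum>i\<in>I. Poly_Mapping.single (g i, h) (c i)) \<in> dual_null"
  using assms
proof (induction I)
  case empty
  \<comment> \<open>The zero function is written as \<open>0 * h\<close> so that the scaling relator
    with coefficient \<open>0\<close> applies.\<close>
  have "(\<lambda>u\<in>carrier H. \<Sum>i\<in>{}. c i * g i u) = (\<lambda>u\<in>carrier H. 0 * h u)"
    by (rule restrict_ext) simp
  then show ?case using dual_null_smult(1)[of h h 0] empty by (simp only: sum.empty single_zero)
next
  case (insert i I)
  let ?s = "\<lambda>u\<in>carrier H. \<Sum>i\<in>I. c i * g i u" and ?t = "\<lambda>u\<in>carrier H. c i * g i u"
  have s: "?s \<in> dual_carrier H" "?t \<in> dual_carrier H"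
    using insert dual_subspace_sum[OF dual_subspace_dual_carrier, of I g c]
    by (auto simp: dual_carrier_smult)
  have eq: "(\<lambda>u\<in>carrier H. \<Sum>i\<in>insert i I. c i * g i u) = (\<lambda>u\<in>carrier H. ?t u + ?s u)"
    by (rule restrict_ext) (use insert in simp)
  have "Poly_Mapping.single (?s, h) 1 - (\<Sum>i\<in>I. Poly_Mapping.single (g i, h) (c i)) \<in> dual_null"
    by (rule insert.IH) (use insert.prems in auto)
  moreover have "Poly_Mapping.single (?t, h) 1 - Poly_Mapping.single (g i, h) (c i) \<in> dual_null"
    by (rule dual_null_smult) (use insert.prems in auto)
  moreover note dual_null_add(1)[OF s(2,1) insert.prems(2)]
  ultimately have "(Poly_Mapping.single (\<lambda>u\<in>carrier H. ?t u + ?s u, h) 1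
      - Poly_Mapping.single (?t, h) 1 - Poly_Mapping.single (?s, h) 1)
    + (Poly_Mapping.single (?s, h) 1 - (\<Sum>i\<in>I. Poly_Mapping.single (g i, h) (c i)))
    + (Poly_Mapping.single (?t, h) 1 - Poly_Mapping.single (g i, h) (c i)) \<in> dual_null"
    by (intro dual_null_closed(2))
  then show ?case
    unfolding eq by (simp add: insert.hyps algebra_simps del: restrict_apply)
qed

text \<open>
  Injectivity of \<open>H\<^sup>* \<otimes> H\<^sup>* \<rightarrow> (H \<otimes> H)\<^sup>*\<close>: if some \<open>h i0\<close> does not vanish at \<open>v\<close>, then evaluating
  at \<open>v\<close> expresses \<open>g i0\<close> through the other \<open>g i\<close>, and the term \<open>i0\<close> can be absorbed.
\<close>

lemma dual_null_sumI:
  assumes "finite I" "\<And>i. i \<in> I \<Longrightarrow> g i \<in> dual_carrier H" "\<And>i. i \<in> I \<Longrightarrow> h i \<in> dual_carrier H"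
    and "\<And>u v. \<lbrakk>u \<in> carrier H; v \<in> carrier H\<rbrakk> \<Longrightarrow> (\<Sum>i\<in>I. g i u * h i v) = 0"
  shows "(\<Sum>i\<in>I. Poly_Mapping.single (g i, h i) 1) \<in> dual_null"
  using assms
\<comment> \<open>Absorbing a term removes an index and changes the right factors, so
  \<open>I\<close> and \<open>h\<close> vary while \<open>g\<close> stays fixed.\<close>
proof (induction "card I" arbitrary: I h)
  case 0
  then show ?case by (simp add: dual_null_closed)
next
  case (Suc m)
  show ?case
  proof (cases "\<forall>i\<in>I. \<forall>v\<in>carrier H. h i v = 0")
    case True
    have "h i = (\<lambda>u\<in>carrier H. 0)" if "i \<in> I" for i
      by (rule dual_carrier_eqI[OF Suc(5)[OF that] dual_carrier_zero]) (use True that in simp)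
    then show ?thesis
      using Suc by (intro dual_null_closed) (simp add: dual_null_single_zero)
  next
    case False
    then obtain i0 v where i0: "i0 \<in> I" "v \<in> carrier H" "h i0 v \<noteq> 0" by auto
    define J where "J = I - {i0}"
    define c where "c i = - (h i v / h i0 v)" for i
    have J: "finite J" "card J = m" "i0 \<notin> J" "I = insert i0 J" "J \<subseteq> I"
      using Suc(2,3) i0 by (auto simp: J_def)
    \<comment> \<open>Modulo \<open>dual_null\<close>, \<open>g i0 \<otimes> h i0\<close> is the sum
      of \<open>c i * (g i \<otimes> h i0)\<close> over \<open>J\<close>. Merging it with the other
      terms turns each \<open>h i\<close> into \<open>h' i\<close>.\<close>
    define h' where "h' i = (\<lambda>w\<in>carrier H. h i w + c i * h i0 w)" for i
    have g0: "g i0 = (\<lambda>u\<in>carrier H. \<Sum>i\<in>J. c i * g i u)"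
    proof (rule dual_carrier_eqI)
      show "(\<lambda>u\<in>carrier H. \<Sum>i\<in>J. c i * g i u) \<in> dual_carrier H"
        using Suc(4) J by (intro dual_subspace_sum dual_subspace_dual_carrier) auto
      fix u assume u: "u \<in> carrier H"
      have "g i0 u * h i0 v = - (\<Sum>i\<in>J. g i u * h i v)"
        using Suc(6)[OF u i0(2)] J by (simp add: eq_neg_iff_add_eq_0)
      then have "g i0 u = - (\<Sum>i\<in>J. g i u * h i v) / h i0 v"
        using i0(3) by (simp add: field_simps)
      then show "g i0 u = (\<lambda>u\<in>carrier H. \<Sum>i\<in>J. c i * g i u) u"
        using u by (simp add: c_def sum_divide_distrib sum_negf mult.commute)
    qed (use Suc(4) i0 in auto)
    have ch: "(\<lambda>w\<in>carrier H. c i * h i0 w) \<in> dual_carrier H" for i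
      using Suc(5) i0 by (simp add: dual_carrier_smult)
    have h'_eq: "h' i = (\<lambda>w\<in>carrier H. h i w + (\<lambda>w\<in>carrier H. c i * h i0 w) w)" for i
      unfolding h'_def by (rule restrict_ext) simp
    have h': "h' i \<in> dual_carrier H" if "i \<in> J" for i
      unfolding h'_eq by (intro dual_carrier_add ch Suc(5)) (use J(5) that in auto)
    have "(\<Sum>i\<in>J. Poly_Mapping.single (g i, h' i) 1) \<in> dual_null"
    proof (rule Suc(1))
      fix u w assume uw: "u \<in> carrier H" "w \<in> carrier H"
      have "(\<Sum>i\<in>J. g i u * h' i w) = (\<Sum>i\<in>J. g i u * h i w) + (\<Sum>i\<in>J. c i * g i u) * h i0 w"
        using uw by (simp add: h'_def algebra_simps sum.distrib sum_distrib_left)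
      also have "(\<Sum>i\<in>J. c i * g i u) = g i0 u"
        using uw by (subst g0) simp
      also have "(\<Sum>i\<in>J. g i u * h i w) + g i0 u * h i0 w = (\<Sum>i\<in>I. g i u * h i w)"
        using J by simp
      finally show "(\<Sum>i\<in>J. g i u * h' i w) = 0"
        using Suc(6) uw by simp
    qed (use J Suc(4) h' in auto)
    moreover have "(\<Sum>i\<in>J. (Poly_Mapping.single (g i, h' i) 1 - Poly_Mapping.single (g i, h i) 1
          - Poly_Mapping.single (g i, \<lambda>w\<in>carrier H. c i * h i0 w) 1)
        + (Poly_Mapping.single (g i, \<lambda>w\<in>carrier H. c i * h i0 w) 1
          - Poly_Mapping.single (g i, h i0) (c i))) \<in> dual_null"
      unfolding h'_eq using J(5)
      by (intro dual_null_closed(2,4) dual_null_add dual_null_smult ch Suc(4,5) i0(1)) auto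
    moreover have "Poly_Mapping.single (g i0, h i0) 1
        - (\<Sum>i\<in>J. Poly_Mapping.single (g i, h i0) (c i)) \<in> dual_null"
      by (subst g0, rule dual_null_sum_left) (use J Suc(4,5) in auto)
    \<comment> \<open>Subtracting the relators that split \<open>h' i\<close> and adding those that
      expand \<open>g i0\<close> telescopes to the sum over \<open>I\<close>.\<close>
    ultimately have "(\<Sum>i\<in>J. Poly_Mapping.single (g i, h' i) 1)
        - (\<Sum>i\<in>J. (Poly_Mapping.single (g i, h' i) 1 - Poly_Mapping.single (g i, h i) 1
          - Poly_Mapping.single (g i, \<lambda>w\<in>carrier H. c i * h i0 w) 1)
          + (Poly_Mapping.single (g i, \<lambda>w\<in>carrier H. c i * h i0 w) 1
          - Poly_Mapping.single (g i, h i0) (c i)))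
        + (Poly_Mapping.single (g i0, h i0) 1
        - (\<Sum>i\<in>J. Poly_Mapping.single (g i, h i0) (c i))) \<in> dual_null"
      by (intro dual_null_closed(2) dual_null_closed(3)[of "\<Sum>i\<in>J. Poly_Mapping.single (g i, h' i) 1"])
    then show ?thesis
      using J by (simp add: sum_subtractf sum.distrib algebra_simps)
  qed
qed

text \<open>Coefficients are moved into the right factors to reach the coefficient-free families of
  \<open>dual_null_sumI\<close>; the discrepancy consists of scaling relators.\<close>

lemma dual_nullI:
  assumes "Poly_Mapping.keys p \<subseteq> dual_carrier H \<times> dual_carrier H"
    and "\<And>u v. \<lbrakk>u \<in> carrier H; v \<in> carrier H\<rbrakk> \<Longrightarrow> pairing u v p = 0"
  shows "p \<in> dual_null"
proof -
  let ?K = "Poly_Mapping.keys p" and ?c = "Poly_Mapping.lookup p"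
  let ?h = "\<lambda>s. \<lambda>v\<in>carrier H. ?c s * snd s v"
  have K: "fst s \<in> dual_carrier H" "snd s \<in> dual_carrier H" if "s \<in> ?K" for s
    using assms(1) that by auto
  have "(\<Sum>s\<in>?K. Poly_Mapping.single (fst s, ?h s) 1) \<in> dual_null"
    using assms(2) K
    by (intro dual_null_sumI) (auto simp: pairing_def lin_ext_def mult_ac intro!: dual_carrier_smult)
  moreover have "(\<Sum>s\<in>?K. Poly_Mapping.single (fst s, ?h s) 1
      - Poly_Mapping.single (fst s, snd s) (?c s)) \<in> dual_null"
    using K by (intro dual_null_closed dual_null_smult) auto
  ultimately have "(\<Sum>s\<in>?K. Poly_Mapping.single (fst s, ?h s) 1)
      - (\<Sum>s\<in>?K. Poly_Mapping.single (fst s, ?h s) 1 - Poly_Mapping.single (fst s, snd s) (?c s))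
      \<in> dual_null"
    by (rule dual_null_closed(3))
  then show ?thesis
    by (subst poly_mapping_sum_singles) (simp add: sum_subtractf)
qed

section \<open>Subcoalgebras, representatives of the comultiplication, and translations\<close>

lemma subcoalgebraI:
  assumes "dual_subspace C"
    and "\<And>f. f \<in> C \<Longrightarrow> \<exists>p. Poly_Mapping.keys p \<subseteq> C \<times> C \<and>
      (\<forall>u\<in>carrier H. \<forall>v\<in>carrier H. f (u \<otimes> v) = pairing u v p)"
  shows "subcoalgebra dual C"
  unfolding subcoalgebra_def submodule_dual_iff
proof safe
  fix f assume "f \<in> C"
  then obtain p where p: "Poly_Mapping.keys p \<subseteq> C \<times> C"
    "\<And>u v. \<lbrakk>u \<in> carrier H; v \<in> carrier H\<rbrakk> \<Longrightarrow> f (u \<otimes> v) = pairing u v p"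
    using assms(2) by metis
  have pD: "Poly_Mapping.keys p \<subseteq> dual_carrier H \<times> dual_carrier H"
    using p(1) assms(1) by (auto simp: dual_subspace_def)
  \<comment> \<open>\<open>comult dual f\<close> collects all formal sums representing
    \<open>f (u \<otimes> v)\<close>. Two of them differ by an element with zero pairing, so one
    representative \<open>p\<close> determines the whole coset.\<close>
  have "comult dual f = (+) p ` dual_null"
  proof (intro equalityI subsetI)
    fix p' assume p': "p' \<in> comult dual f"
    have "p' - p \<in> dual_null"
      using p' pD p(2) keys_diff[of p' p]
      by (intro dual_nullI) (auto simp: comult_dual pairing_def lin_ext_diff)
    moreover have "p' = p + (p' - p)" by simp
    ultimately show "p' \<in> (+) p ` dual_null" by (rule rev_image_eqI)
  next
    fix p' assume "p' \<in> (+) p ` dual_null"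
    then obtain z where z: "p' = p + z" "z \<in> dual_null" by auto
    then show "p' \<in> comult dual f"
      using dual_null_vanishes[OF z(2)] pD p(2) Poly_Mapping.keys_add[of p z]
      by (auto simp: comult_dual pairing_def lin_ext_add)
  qed
  then show "comult dual f \<in> tensor_class dual dual ` {p. Poly_Mapping.keys p \<subseteq> C \<times> C}"
    using p(1) by (auto simp: tensor_class_def)
qed (rule assms(1))

text \<open>Fixing one argument in a representative supported in \<open>C \<times> C\<close> writes
  a translate of \<open>f\<close> as a linear combination of elements of \<open>C\<close>.\<close>

lemma subcoalgebraD:
  assumes "subcoalgebra dual C"
  shows "dual_subspace C"
    and "\<lbrakk>f \<in> C; v \<in> carrier H\<rbrakk> \<Longrightarrow> (\<lambda>u\<in>carrier H. f (u \<otimes> v)) \<in> C"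
    and "\<lbrakk>f \<in> C; v \<in> carrier H\<rbrakk> \<Longrightarrow> (\<lambda>u\<in>carrier H. f (v \<otimes> u)) \<in> C"
proof -
  show C: "dual_subspace C"
    using assms by (simp add: subcoalgebra_def submodule_dual_iff)
  assume f: "f \<in> C" and v: "v \<in> carrier H"
  obtain p where p: "Poly_Mapping.keys p \<subseteq> C \<times> C" "comult dual f = (+) p ` dual_null"
    using assms f by (auto simp: subcoalgebra_def tensor_class_def)
  have "p \<in> comult dual f"
    unfolding p(2) using dual_null_closed(1) by (rule rev_image_eqI) simp
  then have fp: "f (u \<otimes> v) = pairing u v p" if "u \<in> carrier H" "v \<in> carrier H" for u v
    using that by (auto simp: comult_dual)
  have "(\<lambda>u\<in>carrier H. f (u \<otimes> v)) = (\<lambda>u\<in>carrier H. \<Sum>s\<in>Poly_Mapping.keys p.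
      (Poly_Mapping.lookup p s * snd s v) * fst s u)"
    by (rule restrict_ext) (simp add: fp v pairing_def lin_ext_def mult_ac)
  also have "\<dots> \<in> C"
    by (rule dual_subspace_sum[OF C]) (use p(1) in auto)
  finally show "(\<lambda>u\<in>carrier H. f (u \<otimes> v)) \<in> C" .
  have "(\<lambda>u\<in>carrier H. f (v \<otimes> u)) = (\<lambda>u\<in>carrier H. \<Sum>s\<in>Poly_Mapping.keys p.
      (Poly_Mapping.lookup p s * fst s v) * snd s u)"
    by (rule restrict_ext) (simp add: fp v pairing_def lin_ext_def mult_ac)
  also have "\<dots> \<in> C"
    by (rule dual_subspace_sum[OF C]) (use p(1) in auto)
  finally show "(\<lambda>u\<in>carrier H. f (v \<otimes> u)) \<in> C" .
qed

end

section \<open>Finite spans in the dual and their dimension\<close>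

context algebra_over_field
begin

definition dual_span :: "'i set \<Rightarrow> ('i \<Rightarrow> 'h \<Rightarrow> 'k) \<Rightarrow> ('h \<Rightarrow> 'k) set"
  where "dual_span I g = range (\<lambda>c. \<lambda>u\<in>carrier H. \<Sum>i\<in>I. c i * g i u)"

lemma dual_span_memI: "(\<lambda>u\<in>carrier H. \<Sum>i\<in>I. c i * g i u) \<in> dual_span I g"
  by (auto simp: dual_span_def)

lemma dual_span_base:
  assumes "finite I" "i \<in> I" "g i \<in> dual_carrier H"
  shows "g i \<in> dual_span I g"
proof -
  have "g i = (\<lambda>u\<in>carrier H. g i u)"
    using assms(3) by (simp add: dual_carrier_def extensional_restrict)
  also have "\<dots> = (\<lambda>u\<in>carrier H. \<Sum>j\<in>I. (if j = i then 1 else 0) * g j u)"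
    by (rule restrict_ext) (simp add: assms if_distrib[where f = "\<lambda>c. c * _"] cong: if_cong)
  also have "\<dots> \<in> dual_span I g" by (rule dual_span_memI)
  finally show ?thesis .
qed

lemma dual_subspace_span:
  assumes "\<And>i. i \<in> I \<Longrightarrow> g i \<in> dual_carrier H"
  shows "dual_subspace (dual_span I g)"
  unfolding dual_subspace_def
proof (intro conjI ballI allI)
  show "dual_span I g \<subseteq> dual_carrier H"
    using dual_subspace_sum[OF dual_subspace_dual_carrier, of I g] assms
    by (auto simp: dual_span_def simp del: restrict_apply)
  have "(\<lambda>u\<in>carrier H. 0) = (\<lambda>u\<in>carrier H. \<Sum>i\<in>I. 0 * g i u)"
    by (rule restrict_ext) simp
  then show "(\<lambda>u\<in>carrier H. 0) \<in> dual_span I g"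
    by (simp only: dual_span_memI)
next
  fix f f' assume "f \<in> dual_span I g" "f' \<in> dual_span I g"
  then obtain c c' where c: "f = (\<lambda>u\<in>carrier H. \<Sum>i\<in>I. c i * g i u)"
    "f' = (\<lambda>u\<in>carrier H. \<Sum>i\<in>I. c' i * g i u)"
    by (auto simp: dual_span_def)
  have "(\<lambda>u\<in>carrier H. f u + f' u) = (\<lambda>u\<in>carrier H. \<Sum>i\<in>I. (c i + c' i) * g i u)"
    by (rule restrict_ext) (simp add: c sum.distrib distrib_right)
  then show "(\<lambda>u\<in>carrier H. f u + f' u) \<in> dual_span I g"
    by (simp only: dual_span_memI)
next
  fix f d assume "f \<in> dual_span I g"
  then obtain c where c: "f = (\<lambda>u\<in>carrier H. \<Sum>i\<in>I. c i * g i u)"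
    by (auto simp: dual_span_def)
  have "(\<lambda>u\<in>carrier H. d * f u) = (\<lambda>u\<in>carrier H. \<Sum>i\<in>I. (d * c i) * g i u)"
    by (rule restrict_ext) (simp add: c sum_distrib_left mult.assoc)
  then show "(\<lambda>u\<in>carrier H. d * f u) \<in> dual_span I g"
    by (simp only: dual_span_memI)
qed

lemma dual_span_subset:
  assumes "dual_subspace C" "\<And>i. i \<in> I \<Longrightarrow> g i \<in> C"
  shows "dual_span I g \<subseteq> C"
  using dual_subspace_sum[OF assms] by (auto simp: dual_span_def simp del: restrict_apply)

text \<open>The \<open>e j\<close> form a dual system: evaluation at \<open>e j\<close> reads off
  the coefficient of \<open>g j\<close>, which gives injectivity of \<open>g\<close> and uniqueness
  of coordinates.\<close>

lemma has_dimension_dual_span: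
  assumes I: "finite I" and g: "\<And>i. i \<in> I \<Longrightarrow> g i \<in> dual_carrier H"
    and e: "\<And>i. i \<in> I \<Longrightarrow> e i \<in> carrier H"
    and ge: "\<And>i j. \<lbrakk>i \<in> I; j \<in> I\<rbrakk> \<Longrightarrow> g i (e j) = (if i = j then 1 else 0)"
  shows "has_dimension dual (dual_span I g) (card I)"
proof -
  have inj: "inj_on g I"
    by (rule inj_onI) (metis ge one_neq_zero)
  have fs: "(\<Oplus>\<^bsub>dual\<^esub>b\<in>g ` I. d b \<odot>\<^bsub>dual\<^esub> b) = (\<lambda>u\<in>carrier H. \<Sum>i\<in>I. d (g i) * g i u)" for d
  proof -
    have "(\<Oplus>\<^bsub>dual\<^esub>b\<in>g ` I. d b \<odot>\<^bsub>dual\<^esub> b)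
        = (\<lambda>u\<in>carrier H. \<Sum>b\<in>g ` I. (d b \<odot>\<^bsub>dual\<^esub> b) u)"
      by (rule dual_finsum) (use I g in \<open>auto intro!: dual_carrier_smult\<close>)
    also have "\<dots> = (\<lambda>u\<in>carrier H. \<Sum>i\<in>I. d (g i) * g i u)"
      by (rule restrict_ext) (simp add: sum.reindex[OF inj])
    finally show ?thesis .
  qed
  have ex1: "\<exists>!d. d \<in> g ` I \<rightarrow>\<^sub>E UNIV \<and> f = (\<Oplus>\<^bsub>dual\<^esub>b\<in>g ` I. d b \<odot>\<^bsub>dual\<^esub> b)"
    if f: "f \<in> dual_span I g" for f
  proof -
    obtain c where c: "f = (\<lambda>u\<in>carrier H. \<Sum>i\<in>I. c i * g i u)"
      using f by (auto simp: dual_span_def)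
    show ?thesis
    proof (rule ex1I[of _ "\<lambda>b\<in>g ` I. c (the_inv_into I g b)"], goal_cases)
      case 1
      show ?case unfolding fs unfolding c
        by (auto intro!: restrict_ext sum.cong simp: the_inv_into_f_f[OF inj])
    next
      case (2 d)
      have "d (g j) = c j" if "j \<in> I" for j
      proof -
        have "f (e j) = (\<Sum>i\<in>I. (if i = j then c i else 0))"
          unfolding c using e that by (auto simp: ge intro!: sum.cong)
        moreover have "f (e j) = (\<Sum>i\<in>I. (if i = j then d (g i) else 0))"
          using 2 unfolding fs using e that by (auto simp: ge intro!: sum.cong)
        ultimately show ?thesis using I that by simp
      qed
      then show ?case
        using 2 by (auto simp: fun_eq_iff PiE_def extensional_def the_inv_into_f_f[OF inj])
    qed
  qed
  have "g ` I \<subseteq> dual_span I g"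
    using dual_span_base[OF I] g by auto
  then show ?thesis
    unfolding has_dimension_def
    by (intro exI[of _ "g ` I"] conjI ballI finite_imageI I card_image[OF inj] ex1)
qed

lemma has_dimension_one_imp_proportional:
  assumes "has_dimension dual C 1" "C \<subseteq> dual_carrier H"
  obtains b where "\<And>f. f \<in> C \<Longrightarrow> \<exists>d. \<forall>u\<in>carrier H. f u = d * b u"
proof -
  obtain B where BC: "B \<subseteq> C" and B1: "card B = 1"
    and B: "\<forall>v\<in>C. \<exists>!c. c \<in> B \<rightarrow>\<^sub>E (UNIV :: 'k set) \<and> v = (\<Oplus>\<^bsub>dual\<^esub>b\<in>B. c b \<odot>\<^bsub>dual\<^esub> b)"
    using assms(1) unfolding has_dimension_def by (elim exE conjE) (rule that)
  from B1 obtain b where b: "B = {b}" by (auto simp: card_1_singleton_iff)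
  have "\<exists>d. \<forall>u\<in>carrier H. f u = d * b u" if f: "f \<in> C" for f
  proof -
    obtain c where "f = (\<Oplus>\<^bsub>dual\<^esub>b\<in>{b}. c b \<odot>\<^bsub>dual\<^esub> b)"
      using bspec[OF B f] unfolding b by (elim ex1E conjE)
    also have "\<dots> = (\<lambda>u\<in>carrier H. \<Sum>b\<in>{b}. (c b \<odot>\<^bsub>dual\<^esub> b) u)"
      by (rule dual_finsum) (use assms(2) BC b in \<open>auto intro!: dual_carrier_smult\<close>)
    finally show ?thesis by auto
  qed
  then show ?thesis by (rule that)
qed

section \<open>Matrix coefficients\<close>

text \<open>\<open>\<rho>\<close> gives the matrix entries of an \<open>n\<close>-dimensional
  representation and \<open>e k l\<close> a preimage of the matrix unit at \<open>(k, l)\<close>;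
  together they say that \<open>H\<close> maps onto the full matrix algebra.\<close>

context
  fixes n :: nat and \<rho> :: "nat \<Rightarrow> nat \<Rightarrow> 'h \<Rightarrow> 'k" and e :: "nat \<Rightarrow> nat \<Rightarrow> 'h"
  assumes coeff_dual: "\<lbrakk>i < n; j < n\<rbrakk> \<Longrightarrow> \<rho> i j \<in> dual_carrier H"
    and coeff_mult: "\<lbrakk>i < n; j < n; u \<in> carrier H; v \<in> carrier H\<rbrakk>
      \<Longrightarrow> \<rho> i j (u \<otimes> v) = (\<Sum>l<n. \<rho> i l u * \<rho> l j v)"
    and unit_carrier: "\<lbrakk>k < n; l < n\<rbrakk> \<Longrightarrow> e k l \<in> carrier H"
    and coeff_unit: "\<lbrakk>i < n; j < n; k < n; l < n\<rbrakk>
      \<Longrightarrow> \<rho> i j (e k l) = (if i = k \<and> j = l then 1 else 0)"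
begin

definition coeff_space :: "('h \<Rightarrow> 'k) set"
  where "coeff_space = dual_span ({..<n} \<times> {..<n}) (\<lambda>(i, j). \<rho> i j)"

lemma coeff_in_coeff_space: "\<lbrakk>i < n; j < n\<rbrakk> \<Longrightarrow> \<rho> i j \<in> coeff_space"
  using dual_span_base[of "{..<n} \<times> {..<n}" "(i, j)" "\<lambda>(i, j). \<rho> i j"]
  by (simp add: coeff_space_def coeff_dual)

lemma coeff_space_subspace: "dual_subspace coeff_space"
  unfolding coeff_space_def by (rule dual_subspace_span) (auto simp: coeff_dual)

lemma has_dimension_coeff_space: "has_dimension dual coeff_space (n ^ 2)"
proof -
  have "has_dimension dual coeff_space (card ({..<n} \<times> {..<n}))"
    unfolding coeff_space_def
    by (rule has_dimension_dual_span[where e = "\<lambda>(i, j). e i j"])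
      (auto simp: coeff_dual unit_carrier coeff_unit split: if_splits)
  then show ?thesis by (simp add: power2_eq_square)
qed

lemma coeff_space_elim:
  assumes "f \<in> coeff_space"
  obtains c where "\<And>u. u \<in> carrier H \<Longrightarrow> f u = (\<Sum>i<n. \<Sum>j<n. c i j * \<rho> i j u)"
proof -
  obtain c where c: "f = (\<lambda>u\<in>carrier H. \<Sum>s\<in>{..<n} \<times> {..<n}. c s * (case s of (i, j) \<Rightarrow> \<rho> i j) u)"
    using assms by (auto simp: coeff_space_def dual_span_def)
  have "f u = (\<Sum>i<n. \<Sum>j<n. c (i, j) * \<rho> i j u)" if "u \<in> carrier H" for u
    unfolding c using that by (simp add: sum.cartesian_product split_def)
  then show ?thesis using that[of "\<lambda>i j. c (i, j)"] by simp
qed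

lemma subcoalgebra_coeff_space: "subcoalgebra dual coeff_space"
proof (rule subcoalgebraI[OF coeff_space_subspace])
  fix f assume "f \<in> coeff_space"
  then obtain c where c: "\<And>u. u \<in> carrier H \<Longrightarrow> f u = (\<Sum>i<n. \<Sum>j<n. c i j * \<rho> i j u)"
    by (rule coeff_space_elim) blast
  \<comment> \<open>By \<open>coeff_mult\<close>, \<open>\<Delta> (\<rho> i j)\<close> is the sum of
    \<open>\<rho> i l \<otimes> \<rho> l j\<close> over \<open>l\<close>.\<close>
  define p where "p = (\<Sum>i<n. \<Sum>j<n. \<Sum>l<n. Poly_Mapping.single (\<rho> i l, \<rho> l j) (c i j))"
  have "Poly_Mapping.keys p \<subseteq> coeff_space \<times> coeff_space"
    unfolding p_def
    by (auto dest!: subsetD[OF keys_sum] split: if_splits simp: coeff_in_coeff_space)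
  moreover have "f (u \<otimes> v) = pairing u v p" if "u \<in> carrier H" "v \<in> carrier H" for u v
    using that
    by (simp add: c p_def pairing_def lin_ext_sum coeff_mult sum_distrib_left mult.assoc)
  ultimately show "\<exists>p. Poly_Mapping.keys p \<subseteq> coeff_space \<times> coeff_space \<and>
      (\<forall>u\<in>carrier H. \<forall>v\<in>carrier H. f (u \<otimes> v) = pairing u v p)"
    by blast
qed

text \<open>
  If \<open>f = \<Sum> c i j * \<rho> i j\<close> then \<open>f (e k l \<otimes> u \<otimes> e s t) = c k t * \<rho> l s u\<close>, so the translates of a
  nonzero \<open>f\<close> span everything.
\<close>

lemma simple_subcoalgebra_coeff_space:
  assumes "n > 0"
  shows "simple_subcoalgebra dual coeff_space"
  unfolding simple_subcoalgebra_def
proof (intro conjI allI impI)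
  show "subcoalgebra dual coeff_space" by (rule subcoalgebra_coeff_space)
  have "\<rho> 0 0 (e 0 0) \<noteq> (\<lambda>u\<in>carrier H. 0) (e 0 0)"
    using assms by (simp add: coeff_unit unit_carrier)
  then show "coeff_space \<noteq> {\<zero>\<^bsub>dual\<^esub>}"
    using coeff_in_coeff_space[OF assms assms] by (auto simp del: restrict_apply)
  fix E assume E: "subcoalgebra dual E \<and> E \<subseteq> coeff_space"
  then have sub: "dual_subspace E" using subcoalgebraD(1) by blast
  show "E = {\<zero>\<^bsub>dual\<^esub>} \<or> E = coeff_space"
  proof (rule disjCI)
    assume "E \<noteq> coeff_space"
    have "f = (\<lambda>u\<in>carrier H. 0)" if f: "f \<in> E" for f
    proof (rule ccontr)
      assume nz: "f \<noteq> (\<lambda>u\<in>carrier H. 0)"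
      have "f \<in> coeff_space" using E f by blast
      then obtain c where c: "\<And>u. u \<in> carrier H \<Longrightarrow> f u = (\<Sum>i<n. \<Sum>j<n. c i j * \<rho> i j u)"
        by (rule coeff_space_elim) blast
      \<comment> \<open>A nonzero coefficient fixes the outer indices \<open>k\<close> and
        \<open>t\<close> of the sandwich; the inner ones \<open>l\<close> and \<open>s\<close>
        remain free.\<close>
      have "\<exists>k<n. \<exists>t<n. c k t \<noteq> 0"
      proof (rule ccontr)
        assume "\<not> (\<exists>k<n. \<exists>t<n. c k t \<noteq> 0)"
        then have "f = (\<lambda>u\<in>carrier H. 0)"
          using f sub by (intro dual_carrier_eqI[of f H]) (auto simp: c dual_subspace_def)
        with nz show False ..
      qed
      then obtain k t where kt: "k < n" "t < n" "c k t \<noteq> 0" by blast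
      have "\<rho> l s \<in> E" if ls: "l < n" "s < n" for l s
      proof -
        have st: "e k l \<in> carrier H" "e s t \<in> carrier H" using kt ls by (auto simp: unit_carrier)
        let ?h = "\<lambda>v\<in>carrier H. (\<lambda>u\<in>carrier H. f (u \<otimes> e s t)) (e k l \<otimes> v)"
        have h: "?h \<in> E"
          by (intro subcoalgebraD(2,3) f st) (use E in auto)
        have "?h v = c k t * \<rho> l s v" if v: "v \<in> carrier H" for v
        proof -
          have "\<rho> i j (e k l \<otimes> v \<otimes> e s t) = (if i = k then if j = t then \<rho> l s v else 0 else 0)"
            if "i < n" "j < n" for i j
          proof -
            have inner: "\<rho> i m (e k l \<otimes> v) = (if i = k then \<rho> l m v else 0)" if "m < n" for m
            proof -
              have "\<rho> i m (e k l \<otimes> v) = (\<Sum>m'<n. \<rho> i m' (e k l) * \<rho> m' m v)"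
                using \<open>i < n\<close> \<open>m < n\<close> v st by (intro coeff_mult)
              also have "\<dots> = (\<Sum>m'<n. if m' = l then if i = k then \<rho> m' m v else 0 else 0)"
                using \<open>i < n\<close> kt ls by (intro sum.cong) (auto simp: coeff_unit)
              finally show ?thesis using ls by simp
            qed
            have "\<rho> i j (e k l \<otimes> v \<otimes> e s t) = (\<Sum>m<n. \<rho> i m (e k l \<otimes> v) * \<rho> m j (e s t))"
              using that v st by (intro coeff_mult) auto
            also have "\<dots> = (\<Sum>m<n. if m = s then if i = k then if j = t then \<rho> l m v else 0 else 0 else 0)"
              using that kt ls by (intro sum.cong) (auto simp: inner coeff_unit)
            finally show ?thesis using ls by simp
          qed
          then have "?h v = (\<Sum>i<n. \<Sum>j<n. if i = k then if j = t then c i j * \<rho> l s v else 0 else 0)"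
            using v st by (auto simp: c intro!: sum.cong)
          also have "\<dots> = (\<Sum>i<n. if i = k then c i t * \<rho> l s v else 0)"
            using kt by (intro sum.cong) auto
          also have "\<dots> = c k t * \<rho> l s v" using kt by simp
          finally show ?thesis .
        qed
        then have "(\<lambda>v\<in>carrier H. inverse (c k t) * ?h v) = (\<lambda>v\<in>carrier H. \<rho> l s v)"
          using kt by (intro restrict_ext) simp
        moreover have "(\<lambda>v\<in>carrier H. inverse (c k t) * ?h v) \<in> E"
          using h sub unfolding dual_subspace_def by blast
        moreover have "(\<lambda>v\<in>carrier H. \<rho> l s v) = \<rho> l s"
          using coeff_dual[OF ls] by (simp add: dual_carrier_def extensional_restrict)
        ultimately show ?thesis by metis
      qed
      then have "coeff_space \<subseteq> E"
        unfolding coeff_space_def by (intro dual_span_subset sub) auto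
      with E \<open>E \<noteq> coeff_space\<close> show False by blast
    qed
    then show "E = {\<zero>\<^bsub>dual\<^esub>}"
      using sub unfolding dual_subspace_def dual_hopf_simps by blast
  qed
qed

text \<open>Dimension one would make \<open>\<rho> 0 0\<close> and \<open>\<rho> 0 1\<close>
  multiples of one function, but \<open>e 0 0\<close> and \<open>e 0 1\<close> separate them. Both
  indices exist as \<open>n > 1\<close>.\<close>

lemma not_pointed_coeff_space:
  assumes "n > 1"
  shows "\<not> pointed dual"
proof
  assume "pointed dual"
  then have "has_dimension dual coeff_space 1"
    using simple_subcoalgebra_coeff_space assms by (simp add: pointed_def)
  then obtain b where b: "\<And>f. f \<in> coeff_space \<Longrightarrow> \<exists>d. \<forall>u\<in>carrier H. f u = d * b u"
    using has_dimension_one_imp_proportional coeff_space_subspace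
    unfolding dual_subspace_def by blast
  obtain d d' where d: "\<And>u. u \<in> carrier H \<Longrightarrow> \<rho> 0 0 u = d * b u"
    "\<And>u. u \<in> carrier H \<Longrightarrow> \<rho> 0 1 u = d' * b u"
    using b[OF coeff_in_coeff_space[of 0 0]] b[OF coeff_in_coeff_space[of 0 1]] assms by auto
  have "d * b (e 0 0) = 1" "d' * b (e 0 0) = 0" "d' * b (e 0 1) = 1"
    using d[of "e 0 0"] d(2)[of "e 0 1"] assms by (auto simp: unit_carrier coeff_unit)
  then show False by auto
qed

end

end

section \<open>Pointedness in the nilpotent case\<close>

text \<open>
  An annihilating polynomial of minimal degree has a root \<open>\<mu>\<close>; the cofactor of \<open>X - \<mu>\<close> produces an
  eigenfunction with eigenvalue \<open>\<mu>\<close>.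
\<close>

lemma finite_order_eigenfunction:
  fixes f :: "'b \<Rightarrow> 'k::alg_closed_field"
  assumes T: "\<And>u. u \<in> A \<Longrightarrow> T u \<in> A" and N: "N > 0"
    and fN: "\<And>u. u \<in> A \<Longrightarrow> f ((T ^^ N) u) = f u"
    and nz: "u0 \<in> A" "f u0 \<noteq> 0"
  shows "\<exists>\<mu> m c. (\<forall>u\<in>A.
      (\<Sum>i\<le>m. c i * f ((T ^^ i) (T u))) = \<mu> * (\<Sum>i\<le>m. c i * f ((T ^^ i) u))) \<and>
    (\<exists>u\<in>A. (\<Sum>i\<le>m. c i * f ((T ^^ i) u)) \<noteq> 0)"
proof -
  \<comment> \<open>\<open>ev p\<close> is the result of applying to \<open>f\<close> the polynomial
    \<open>p\<close> in the operator of composition with \<open>T\<close>.\<close>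
  define ev where "ev p u = (\<Sum>i\<le>degree p. coeff p i * f ((T ^^ i) u))" for p u
  have ev_le: "ev p u = (\<Sum>i\<le>m. coeff p i * f ((T ^^ i) u))" if "degree p \<le> m" for p u m
    unfolding ev_def
    by (rule sum.mono_neutral_left) (use that in \<open>auto simp: coeff_eq_0\<close>)
  define Z where "Z p \<longleftrightarrow> p \<noteq> 0 \<and> (\<forall>u\<in>A. ev p u = 0)" for p
  let ?P = "monom 1 N - 1 :: 'k poly"
  have "Z ?P"
    unfolding Z_def
  proof (intro conjI ballI)
    have "coeff ?P N = 1" using N by simp
    then show "?P \<noteq> 0" by (metis coeff_0 one_neq_zero)
    fix u assume u: "u \<in> A"
    have "degree ?P \<le> N" using N by (intro degree_diff_le) (simp_all add: degree_monom_le)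
    then have "ev ?P u = (\<Sum>i\<le>N. (if i = N then f ((T ^^ i) u) else 0) - (if i = 0 then f ((T ^^ i) u) else 0))"
      using N by (auto simp: ev_le[of _ N] intro!: sum.cong)
    also have "\<dots> = 0"
      using N fN[OF u] by (simp add: sum_subtractf)
    finally show "ev ?P u = 0" .
  qed
  then obtain p where p: "Z p" and min: "\<And>s. Z s \<Longrightarrow> degree p \<le> degree s"
    using ex_has_least_nat[of Z _ degree] by blast
  \<comment> \<open>A nonzero constant does not annihilate \<open>f\<close>, since
    \<open>f u0 \<noteq> 0\<close>.\<close>
  have "degree p \<noteq> 0"
  proof
    assume "degree p = 0"
    then obtain a where "p = [:a:]" by (rule degree_eq_zeroE)
    then show False using p nz by (auto simp: Z_def ev_def)
  qed
  then obtain \<mu> where \<mu>: "poly p \<mu> = 0"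
    using alg_closed_imp_poly_has_root by blast
  then obtain s where s: "p = [:- \<mu>, 1:] * s"
    by (auto simp: poly_eq_0_iff_dvd elim: dvdE)
  have "s \<noteq> 0" using p s by (auto simp: Z_def)
  then have deg: "degree p = Suc (degree s)"
    unfolding s by (subst degree_mult_eq) auto
  then have "\<not> Z s" using min[of s] by auto
  then have "\<exists>u\<in>A. ev s u \<noteq> 0" using \<open>s \<noteq> 0\<close> by (auto simp: Z_def)
  moreover have "ev s (T u) = \<mu> * ev s u" if u: "u \<in> A" for u
  proof -
    \<comment> \<open>Multiplying a polynomial by \<open>X\<close> amounts to evaluating at
      \<open>T u\<close> instead of \<open>u\<close>, so annihilation by
      \<open>X s - \<mu> s\<close> is the eigenvalue equation for \<open>ev s\<close>.\<close>
    have ps: "p = pCons 0 s - smult \<mu> s" unfolding s by simp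
    have "0 = ev p u" using p u by (simp add: Z_def)
    also have "\<dots> = (\<Sum>i\<le>Suc (degree s). coeff (pCons 0 s) i * f ((T ^^ i) u))
        - (\<Sum>i\<le>Suc (degree s). \<mu> * (coeff s i * f ((T ^^ i) u)))"
      unfolding ev_le[OF eq_refl[OF deg]] by (subst ps) (simp add: sum_subtractf algebra_simps)
    also have "(\<Sum>i\<le>Suc (degree s). coeff (pCons 0 s) i * f ((T ^^ i) u)) = ev s (T u)"
      by (subst sum.atMost_Suc_shift) (simp add: ev_def funpow_swap1)
    also have "(\<Sum>i\<le>Suc (degree s). \<mu> * (coeff s i * f ((T ^^ i) u))) = \<mu> * ev s u"
      by (simp add: ev_le[of s "Suc (degree s)"] sum_distrib_left coeff_eq_0)
    finally show ?thesis by simp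
  qed
  ultimately show ?thesis
    unfolding ev_def by blast
qed

section \<open>Joint eigenfunctions of the generators are multiples of characters\<close>

context algebra_over_field
begin

text \<open>Generation as an algebra, phrased as induction over monomials that grow by one letter on
  the left.\<close>

definition generated_by :: "'h \<Rightarrow> 'h \<Rightarrow> bool"
  where "generated_by a x \<longleftrightarrow> a \<in> carrier H \<and> x \<in> carrier H \<and>
    (\<forall>S. S \<subseteq> carrier H \<longrightarrow> \<one> \<in> S \<longrightarrow> (\<forall>u\<in>S. a \<otimes> u \<in> S) \<longrightarrow> (\<forall>u\<in>S. x \<otimes> u \<in> S) \<longrightarrow>
      (\<forall>u\<in>S. \<forall>v\<in>S. u \<oplus> v \<in> S) \<longrightarrow> (\<forall>c. \<forall>u\<in>S. c \<odot> u \<in> S) \<longrightarrow> carrier H \<subseteq> S)"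

text \<open>By induction along generation, right translation by any \<open>v\<close> scales
  \<open>f\<close> by some \<open>\<chi>\<close>, and \<open>u = \<one>\<close> gives
  \<open>f v = \<chi> * f \<one>\<close>. The form without division holds before
  \<open>f \<one> \<noteq> 0\<close> is known, and later serves to prove it.\<close>

lemma generated_eigenfunction_mult:
  assumes gen: "generated_by a x" and f: "f \<in> dual_carrier H"
    and fa: "\<And>u. u \<in> carrier H \<Longrightarrow> f (u \<otimes> a) = \<mu> * f u"
    and fx: "\<And>u. u \<in> carrier H \<Longrightarrow> f (u \<otimes> x) = 0"
    and uv: "u \<in> carrier H" "v \<in> carrier H"
  shows "f \<one> * f (u \<otimes> v) = f u * f v"
proof -
  let ?S = "{v \<in> carrier H. \<exists>\<chi>. \<forall>u\<in>carrier H. f (u \<otimes> v) = \<chi> * f u}"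
  have ax: "a \<in> carrier H" "x \<in> carrier H" using gen by (auto simp: generated_by_def)
  have "carrier H \<subseteq> ?S"
  proof (rule gen[unfolded generated_by_def, THEN conjunct2, THEN conjunct2, rule_format])
    show "\<one> \<in> ?S" by (auto intro: exI[of _ 1])
  next
    fix v assume "v \<in> ?S"
    then obtain \<chi> where v: "v \<in> carrier H" and \<chi>: "\<And>u. u \<in> carrier H \<Longrightarrow> f (u \<otimes> v) = \<chi> * f u"
      by auto
    have "f (u \<otimes> (a \<otimes> v)) = (\<chi> * \<mu>) * f u" if "u \<in> carrier H" for u
      using that v ax \<chi>[of "u \<otimes> a"] by (simp add: fa m_assoc)
    then show "a \<otimes> v \<in> ?S" using v ax by auto
    have "f (u \<otimes> (x \<otimes> v)) = 0 * f u" if "u \<in> carrier H" for u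
      using that v ax \<chi>[of "u \<otimes> x"] by (simp add: fx m_assoc)
    then show "x \<otimes> v \<in> ?S" using v ax by blast
    fix c
    have "f (u \<otimes> (c \<odot> v)) = (c * \<chi>) * f u" if "u \<in> carrier H" for u
      using that v by (simp add: smult_mult_right dual_smult[OF f] \<chi>)
    then show "c \<odot> v \<in> ?S" using v by (auto simp: smult_closed)
  next
    fix v v' assume "v \<in> ?S" "v' \<in> ?S"
    then obtain \<chi> \<chi>' where v: "v \<in> carrier H" "v' \<in> carrier H"
      and \<chi>: "\<And>u. u \<in> carrier H \<Longrightarrow> f (u \<otimes> v) = \<chi> * f u" "\<And>u. u \<in> carrier H \<Longrightarrow> f (u \<otimes> v') = \<chi>' * f u"
      by auto
    have "f (u \<otimes> (v \<oplus> v')) = (\<chi> + \<chi>') * f u" if "u \<in> carrier H" for u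
      using that v by (simp add: r_distr dual_add[OF f] \<chi> distrib_right)
    then show "v \<oplus> v' \<in> ?S" using v by auto
  qed auto
  then have "v \<in> ?S" using uv(2) by (rule subsetD)
  then obtain \<chi> where \<chi>: "\<And>u. u \<in> carrier H \<Longrightarrow> f (u \<otimes> v) = \<chi> * f u" by blast
  have "f v = \<chi> * f \<one>" using \<chi>[of \<one>] uv by simp
  then show ?thesis using \<chi>[OF uv(1)] by simp
qed

text \<open>\<open>f / f \<one>\<close> is multiplicative, that is grouplike in the dual, so
  \<open>\<Delta> f\<close> is \<open>f \<otimes> f\<close> divided by
  \<open>f \<one>\<close>.\<close>

lemma character_subcoalgebra:
  assumes f: "f \<in> dual_carrier H" and f1: "f \<one> \<noteq> 0"
    and fm: "\<And>u v. \<lbrakk>u \<in> carrier H; v \<in> carrier H\<rbrakk> \<Longrightarrow> f \<one> * f (u \<otimes> v) = f u * f v"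
  shows "subcoalgebra dual (dual_span {()} (\<lambda>_. f))"
    and "has_dimension dual (dual_span {()} (\<lambda>_. f)) 1"
proof -
  let ?C = "dual_span {()} (\<lambda>_. f)"
  have fC: "f \<in> ?C" using dual_span_base[of "{()}" "()" "\<lambda>_. f"] f by simp
  show "subcoalgebra dual ?C"
  proof (rule subcoalgebraI)
    show "dual_subspace ?C" using f by (intro dual_subspace_span)
    fix g assume "g \<in> ?C"
    then obtain c where c: "g = (\<lambda>u\<in>carrier H. c * f u)"
      by (auto simp: dual_span_def)
    have "g (u \<otimes> v) = pairing u v (Poly_Mapping.single (f, f) (c / f \<one>))"
      if "u \<in> carrier H" "v \<in> carrier H" for u v
      using fm[OF that] f1 that by (simp add: c pairing_def field_simps)
    then show "\<exists>p. Poly_Mapping.keys p \<subseteq> ?C \<times> ?C \<and>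
        (\<forall>u\<in>carrier H. \<forall>v\<in>carrier H. g (u \<otimes> v) = pairing u v p)"
      using fC by (intro exI[of _ "Poly_Mapping.single (f, f) (c / f \<one>)"]) auto
  qed
  show "has_dimension dual ?C 1"
    using has_dimension_dual_span[of "{()}" "\<lambda>_. f" "\<lambda>_. inverse (f \<one>) \<odot> \<one>"] f f1
    by (simp add: smult_closed dual_smult[OF f])
qed

end

lemma pointed_dualI:
  fixes H :: "('k::alg_closed_field, 'h, 's) hopf_scheme" (structure)
  assumes "algebra_over_field H"
    and gen: "algebra_over_field.generated_by H a x"
    and N: "(N::nat) > 0" "a [^] (N::nat) = \<one>" and r: "x [^] (r::nat) = \<zero>"
    and xa: "x \<otimes> a = q \<odot> (a \<otimes> x)"
  shows "pointed (dual_hopf H)"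
  unfolding pointed_def
proof (intro allI impI)
  interpret algebra_over_field H by fact
  have ax: "a \<in> carrier H" "x \<in> carrier H" using gen by (auto simp: generated_by_def)
  fix C assume simple: "simple_subcoalgebra dual C"
  then have C: "subcoalgebra dual C" by (simp add: simple_subcoalgebra_def)
  note sub = subcoalgebraD(1)[OF C]
  have CD: "f \<in> dual_carrier H" if "f \<in> C" for f using sub that by (auto simp: dual_subspace_def)
  have "(\<lambda>u\<in>carrier H. 0) \<in> C" "C \<noteq> {\<lambda>u\<in>carrier H. 0}"
    using simple sub by (simp_all add: simple_subcoalgebra_def dual_subspace_def)
  then obtain f0 where f0C: "f0 \<in> C" "f0 \<noteq> (\<lambda>u\<in>carrier H. 0)" by blast
  then have f0: "f0 \<in> C" "\<exists>u\<in>carrier H. f0 u \<noteq> 0"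
    using dual_carrier_eqI[OF CD[OF f0C(1)] dual_carrier_zero] by auto
  \<comment> \<open>Some power of \<open>x\<close> kills \<open>f0\<close> because
    \<open>x [^] r = \<zero>\<close>. The least one is positive as \<open>f0\<close> is nonzero, and
    translating by the power just below gives a nonzero \<open>f1\<close> killed by
    \<open>x\<close>.\<close>
  define j where "j = (LEAST j::nat. \<forall>u\<in>carrier H. f0 (u \<otimes> x [^] j) = 0)"
  have zero: "f0 \<zero> = 0"
    using dual_add[OF CD[OF f0(1)], of \<zero> \<zero>] by (metis add_cancel_right_right r_zero zero_closed)
  then have "\<forall>u\<in>carrier H. f0 (u \<otimes> x [^] r) = 0" by (simp add: r)
  then have j: "\<forall>u\<in>carrier H. f0 (u \<otimes> x [^] j) = 0"
    unfolding j_def by (rule LeastI[of "\<lambda>j::nat. \<forall>u\<in>carrier H. f0 (u \<otimes> x [^] j) = 0"])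
  have "j \<noteq> 0"
  proof
    assume "j = 0"
    with j have "\<forall>u\<in>carrier H. f0 (u \<otimes> x [^] (0::nat)) = 0" by simp
    then show False using f0(2) by simp
  qed
  then obtain m where m: "j = Suc m" using not0_implies_Suc by blast
  define f1 where "f1 = (\<lambda>u\<in>carrier H. f0 (u \<otimes> x [^] m))"
  have f1C: "f1 \<in> C" unfolding f1_def using ax by (intro subcoalgebraD(2)[OF C] f0(1)) auto
  have "\<not> (\<forall>u\<in>carrier H. f0 (u \<otimes> x [^] m) = 0)"
    using not_less_Least[of m "\<lambda>j::nat. \<forall>u\<in>carrier H. f0 (u \<otimes> x [^] j) = 0"] m unfolding j_def by simp
  then obtain u1 where u1: "u1 \<in> carrier H" "f1 u1 \<noteq> 0" by (auto simp: f1_def)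
  have f1x: "f1 (u \<otimes> x) = 0" if "u \<in> carrier H" for u
  proof -
    have "f0 (u \<otimes> (x \<otimes> x [^] m)) = 0"
      using j that unfolding m nat_pow_Suc2[OF ax(2)] by blast
    then show ?thesis using that ax by (simp add: f1_def m_assoc)
  qed
  have pow: "((\<lambda>u. u \<otimes> a) ^^ i) u = u \<otimes> a [^] i" if "u \<in> carrier H" for i u
    using that ax by (induction i) (simp_all add: m_assoc)
  have T: "u \<otimes> a \<in> carrier H" if "u \<in> carrier H" for u using that ax by simp
  have TN: "f1 (((\<lambda>u. u \<otimes> a) ^^ N) u) = f1 u" if "u \<in> carrier H" for u
    using that by (simp add: pow N(2))
  obtain \<mu> l c where eig: "\<And>u. u \<in> carrier H \<Longrightarrow>
      (\<Sum>i\<le>l. c i * f1 (((\<lambda>u. u \<otimes> a) ^^ i) (u \<otimes> a)))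
        = \<mu> * (\<Sum>i\<le>l. c i * f1 (((\<lambda>u. u \<otimes> a) ^^ i) u))"
    and nz: "\<exists>u\<in>carrier H. (\<Sum>i\<le>l. c i * f1 (((\<lambda>u. u \<otimes> a) ^^ i) u)) \<noteq> 0"
    using finite_order_eigenfunction[of "carrier H" "\<lambda>u. u \<otimes> a" N f1 u1, OF T N(1) TN u1]
    by blast
  \<comment> \<open>A combination of right translates of \<open>f1\<close>, hence in
    \<open>C\<close>; the inner restriction gives the form that \<open>dual_subspace_sum\<close>
    expects.\<close>
  define f where "f = (\<lambda>u\<in>carrier H. \<Sum>i\<le>l. c i * (\<lambda>u\<in>carrier H. f1 (u \<otimes> a [^] i)) u)"
  have f: "f u = (\<Sum>i\<le>l. c i * f1 (u \<otimes> a [^] i))" if "u \<in> carrier H" for u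
    using that by (simp add: f_def)
  have fC: "f \<in> C"
    unfolding f_def using ax
    by (intro dual_subspace_sum[OF sub] subcoalgebraD(2)[OF C] f1C) auto
  have fa: "f (u \<otimes> a) = \<mu> * f u" if "u \<in> carrier H" for u
    using eig[OF that] that ax by (simp add: f pow)
  have fx: "f (u \<otimes> x) = 0" if u: "u \<in> carrier H" for u
  proof -
    \<comment> \<open>Translating by powers of \<open>a\<close> preserves being killed by
      \<open>x\<close>: a factor \<open>a\<close> moves to the left of \<open>x\<close> at the cost
      of \<open>q\<close>, and is absorbed into \<open>w\<close>.\<close>
    have "f1 (w \<otimes> x \<otimes> a [^] i) = 0" if "w \<in> carrier H" for i :: nat and w
      using that
    proof (induction i arbitrary: w)
      case 0
      then show ?case using ax by (simp add: f1x)
    next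
      case (Suc i)
      have "w \<otimes> x \<otimes> a [^] Suc i = w \<otimes> (x \<otimes> a) \<otimes> a [^] i"
        unfolding nat_pow_Suc2[OF ax(1)] using Suc.prems ax by (simp add: m_assoc)
      also have "\<dots> = q \<odot> (w \<otimes> a \<otimes> x \<otimes> a [^] i)"
        using Suc.prems ax by (simp add: xa smult_mult_left smult_mult_right m_assoc)
      finally show ?case
        using Suc ax by (simp add: dual_smult[OF CD[OF f1C]] del: nat_pow_Suc)
    qed
    then show ?thesis using u ax by (simp add: f)
  qed
  have mult: "f \<one> * f (u \<otimes> v) = f u * f v" if "u \<in> carrier H" "v \<in> carrier H" for u v
    by (rule generated_eigenfunction_mult[OF gen CD[OF fC]]) (fact fa fx that)+
  \<comment> \<open>If \<open>f \<one> = 0\<close>, multiplicativity yields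
    \<open>f u * f u = 0\<close> for all \<open>u\<close>, so \<open>f\<close> would vanish.\<close>
  have f1: "f \<one> \<noteq> 0"
  proof
    obtain u where u: "u \<in> carrier H" "f u \<noteq> 0" using nz by (auto simp: f pow)
    assume "f \<one> = 0"
    then show False using mult[OF u(1) u(1)] u by simp
  qed
  let ?E = "dual_span {()} (\<lambda>_. f)"
  note E = character_subcoalgebra[OF CD[OF fC] f1 mult]
  have "?E \<subseteq> C" using fC by (intro dual_span_subset[OF sub])
  moreover have "?E \<noteq> {\<zero>\<^bsub>dual\<^esub>}"
  proof
    assume "?E = {\<zero>\<^bsub>dual\<^esub>}"
    moreover have "f \<in> ?E" using dual_span_base[of "{()}" "()" "\<lambda>_. f"] CD[OF fC] by simp
    ultimately show False using f1 by simp
  qed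
  ultimately have "?E = C"
    using simple E(1) unfolding simple_subcoalgebra_def by blast
  then show "has_dimension dual C 1" using E(2) by simp
qed

section \<open>The algebra \<open>H\<close> by generators and relations\<close>

lemma ring_of_type_algebra_simps [simp]:
  "carrier ring_of_type_algebra = UNIV"
  "monoid.mult ring_of_type_algebra = (*)"
  "one ring_of_type_algebra = 1"
  "ring.add ring_of_type_algebra = (+)"
  "ring.zero ring_of_type_algebra = 0"
  by (simp_all add: ring_of_type_algebra_def)

lemma ring_ring_of_type_algebra: "ring (ring_of_type_algebra :: 'a::ring_1 ring)"
proof -
  have "\<exists>y. y + x = 0" for x :: 'a
    by (rule exI[of _ "- x"]) simp
  then show ?thesis
    by (intro ringI abelian_groupI monoidI) (auto simp: algebra_simps)
qed

lemma a_inv_ring_of_type_algebra [simp]: "a_inv ring_of_type_algebra p = (- p :: 'a::ring_1)"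
  by (rule abelian_group.minus_equality[OF ring.is_abelian_group[OF ring_ring_of_type_algebra]]) auto

section \<open>Computing in the quotient on representatives\<close>

context
  fixes n N \<nu> :: nat and q \<alpha> :: "'k::field"
begin

private abbreviation (input) "H \<equiv> H_hopf n q N \<nu> \<alpha>"
private abbreviation (input) "cls \<equiv> H_class n q N \<nu> \<alpha>"

lemma ideal_H_ideal: "ideal (H_ideal n q N \<nu> \<alpha>) ring_of_type_algebra"
  unfolding H_ideal_def by (rule ring.genideal_ideal[OF ring_ring_of_type_algebra]) simp

lemma H_ideal_relation: "p \<in> H_relations n q N \<nu> \<alpha> \<Longrightarrow> p \<in> H_ideal n q N \<nu> \<alpha>"
  unfolding H_ideal_def
  using ring.genideal_self[OF ring_ring_of_type_algebra, of "H_relations n q N \<nu> \<alpha>"] by auto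

lemma H_class_eq: "cls p = (\<lambda>z. z + p) ` H_ideal n q N \<nu> \<alpha>"
  by (auto simp: H_class_def a_r_coset_def')

lemma H_class_eqI:
  assumes "p - p' \<in> H_ideal n q N \<nu> \<alpha>"
  shows "cls p = cls p'"
proof -
  interpret ideal "H_ideal n q N \<nu> \<alpha>" ring_of_type_algebra by (rule ideal_H_ideal)
  have closed: "z + y \<in> H_ideal n q N \<nu> \<alpha>" "- z \<in> H_ideal n q N \<nu> \<alpha>"
    if "z \<in> H_ideal n q N \<nu> \<alpha>" "y \<in> H_ideal n q N \<nu> \<alpha>" for z y
    using that additive_subgroup.a_closed[OF additive_subgroup_axioms, of z y] I_l_closed[of z "- 1"]
    by auto
  have sub: "cls p \<subseteq> cls p'" if pp': "p - p' \<in> H_ideal n q N \<nu> \<alpha>" for p p'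
  proof
    fix y assume "y \<in> cls p"
    then obtain z where z: "z \<in> H_ideal n q N \<nu> \<alpha>" "y = z + p" by (auto simp: H_class_eq)
    then have "y = (z + (p - p')) + p'" by simp
    then show "y \<in> cls p'" using closed(1)[OF z(1) pp'] unfolding H_class_eq by blast
  qed
  show ?thesis
    using sub[OF assms] sub[of p' p] closed(2)[OF assms assms] by auto
qed

lemma H_hopf_ops:
  shows carrier_H: "carrier H = range cls"
    and mult_H: "cls p \<otimes>\<^bsub>H\<^esub> cls p' = cls (p * p')"
    and add_H: "cls p \<oplus>\<^bsub>H\<^esub> cls p' = cls (p + p')"
    and one_H: "\<one>\<^bsub>H\<^esub> = cls 1"
    and zero_H: "\<zero>\<^bsub>H\<^esub> = cls 0"
    and smult_H: "c \<odot>\<^bsub>H\<^esub> cls p = cls (scal c * p)"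
proof -
  interpret ideal "H_ideal n q N \<nu> \<alpha>" ring_of_type_algebra by (rule ideal_H_ideal)
  note ops = H_hopf_def H_alg_def Let_def ring.defs module.defs FactRing_def
  show "carrier H = range cls"
    by (auto simp: ops A_RCOSETS_def' H_class_def)
  show mult: "cls p \<otimes>\<^bsub>H\<^esub> cls p' = cls (p * p')" for p p'
    using rcoset_mult_add[of p p'] by (simp add: ops H_class_def)
  show "cls p \<oplus>\<^bsub>H\<^esub> cls p' = cls (p + p')"
    using a_rcos_sum[of p p'] by (simp add: ops H_class_def)
  show "\<one>\<^bsub>H\<^esub> = cls 1" by (simp add: ops H_class_def)
  show "\<zero>\<^bsub>H\<^esub> = cls 0" by (simp add: ops H_class_eq)
  show "c \<odot>\<^bsub>H\<^esub> cls p = cls (scal c * p)"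
    using mult[of "scal c" p] by (simp add: ops)
qed

text \<open>Scaling in the quotient is left multiplication by the class of a scalar, so centrality
  is what lets scalars pass a left factor.\<close>

lemma scal_commute: "scal c * p = p * scal c"
proof (induction p rule: poly_mapping_linear_induct)
  case (single s d)
  then show ?case by (simp add: mult_single mult.commute)
qed (simp add: distrib_left distrib_right)

lemma algebra_over_field_H: "algebra_over_field H"
proof (rule algebra_over_field.intro)
  have "abelian_group H"
  proof (rule abelian_groupI, goal_cases)
    case (6 u)
    then obtain p where "u = cls p" by (auto simp: carrier_H)
    then show ?case
      by (intro bexI[of _ "cls (- p)"]) (auto simp: carrier_H add_H zero_H)
  qed (auto simp: carrier_H add_H zero_H ac_simps)
  moreover have "Group.monoid H"
    by (rule monoidI) (auto simp: carrier_H mult_H one_H mult.assoc)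
  ultimately show "ring H"
    by (rule ringI) (auto simp: carrier_H mult_H add_H distrib_left distrib_right)
next
  fix u v and c :: 'k
  assume "u \<in> carrier H"
  then obtain p where p: "u = cls p" by (auto simp: carrier_H)
  then show "c \<odot>\<^bsub>H\<^esub> u \<in> carrier H" by (auto simp: smult_H carrier_H)
  assume "v \<in> carrier H"
  then obtain p' where p': "v = cls p'" by (auto simp: carrier_H)
  show "c \<odot>\<^bsub>H\<^esub> u \<otimes>\<^bsub>H\<^esub> v = c \<odot>\<^bsub>H\<^esub> (u \<otimes>\<^bsub>H\<^esub> v)"
    by (simp add: p p' smult_H mult_H mult.assoc)
  show "u \<otimes>\<^bsub>H\<^esub> (c \<odot>\<^bsub>H\<^esub> v) = c \<odot>\<^bsub>H\<^esub> (u \<otimes>\<^bsub>H\<^esub> v)"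
    using scal_commute[of c p] by (simp add: p p' smult_H mult_H flip: mult.assoc)
qed

lemma nat_pow_H: "cls p [^]\<^bsub>H\<^esub> (m::nat) = cls (p ^ m)"
  by (induction m) (simp_all add: one_H mult_H power_commutes)

lemma generated_by_H: "algebra_over_field.generated_by H (cls gen_a) (cls gen_x)"
proof -
  interpret algebra_over_field H by (rule algebra_over_field_H)
  show ?thesis
    unfolding generated_by_def
  proof (intro conjI allI impI subsetI)
    fix S u
    assume S1: "\<one>\<^bsub>H\<^esub> \<in> S" and Sa: "\<forall>u\<in>S. cls gen_a \<otimes>\<^bsub>H\<^esub> u \<in> S"
      and Sx: "\<forall>u\<in>S. cls gen_x \<otimes>\<^bsub>H\<^esub> u \<in> S"
      and Sadd: "\<forall>u\<in>S. \<forall>v\<in>S. u \<oplus>\<^bsub>H\<^esub> v \<in> S" and Ssm: "\<forall>c. \<forall>u\<in>S. c \<odot>\<^bsub>H\<^esub> u \<in> S"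
    assume "u \<in> carrier H"
    then obtain p where u: "u = cls p" by (auto simp: carrier_H)
    have word: "cls (Poly_Mapping.single (Word ls) 1) \<in> S" for ls
    proof (induction ls)
      case Nil
      then show ?case using S1 by (simp add: one_H flip: zero_word_def)
    next
      case (Cons l ls)
      have "Poly_Mapping.single (Word (l # ls)) (1::'k)
          = Poly_Mapping.single (Word [l]) 1 * Poly_Mapping.single (Word ls) 1"
        by (simp add: mult_single plus_word_def)
      then show ?case
        using Cons Sa Sx by (cases l) (auto simp flip: mult_H)
    qed
    have "cls p \<in> S"
    proof (induction p rule: poly_mapping_linear_induct)
      case (single s c)
      have "Poly_Mapping.single s c = scal c * Poly_Mapping.single (Word (letters s)) 1"
        by (simp add: mult_single)
      then show ?case using word[of "letters s"] Ssm by (auto simp flip: smult_H)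
    next
      case (add p p')
      then show ?case using Sadd by (auto simp flip: add_H)
    qed
    then show "u \<in> S" by (simp add: u)
  qed (auto simp: carrier_H)
qed

end

lemma pointed_H:
  fixes q :: "'k::alg_closed_field"
  assumes "N > 0"
  shows "pointed (dual_hopf (H_hopf n q N \<nu> 0))"
proof (rule pointed_dualI[OF algebra_over_field_H generated_by_H assms])
  let ?H = "H_hopf n q N \<nu> (0::'k)" and ?c = "H_class n q N \<nu> (0::'k)"
  show "?c gen_a [^]\<^bsub>?H\<^esub> N = \<one>\<^bsub>?H\<^esub>"
    unfolding nat_pow_H one_H
    by (intro H_class_eqI H_ideal_relation) (simp add: H_relations_def)
  show "?c gen_x [^]\<^bsub>?H\<^esub> mult_order (q ^ \<nu>) = \<zero>\<^bsub>?H\<^esub>"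
    unfolding nat_pow_H zero_H
    by (intro H_class_eqI H_ideal_relation) (simp add: H_relations_def)
  show "?c gen_x \<otimes>\<^bsub>?H\<^esub> ?c gen_a = q \<odot>\<^bsub>?H\<^esub> (?c gen_a \<otimes>\<^bsub>?H\<^esub> ?c gen_x)"
    unfolding mult_H smult_H
    by (intro H_class_eqI H_ideal_relation) (simp add: H_relations_def mult.assoc)
qed

section \<open>Roots of unity\<close>

text \<open>Makes the eigenvalues \<open>l * q ^ i\<close> with \<open>i < n\<close>
  distinct.\<close>

lemma primitive_root_of_unity_inj:
  assumes q: "primitive_root_of_unity n (q::'k::field)" and "i < n" "j < n" "q ^ i = q ^ j"
  shows "i = j"
proof -
  have "q ^ n = 1" "n > 0" using q by (auto simp: primitive_root_of_unity_def)
  then have q0: "q \<noteq> 0" by (metis power_0_left not_gr0 zero_neq_one)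
  have *: "\<not> i < j" if "i < n" "j < n" "q ^ i = q ^ j" for i j
  proof
    assume ij: "i < j"
    have "q ^ j = q ^ i * q ^ (j - i)" using ij by (simp flip: power_add)
    then have "q ^ (j - i) = 1" using that(3) q0 by simp
    moreover have "q ^ (j - i) \<noteq> 1"
      using q ij that(2) by (simp add: primitive_root_of_unity_def)
    ultimately show False by simp
  qed
  show ?thesis using *[of i j] *[of j i] assms by force
qed

text \<open>
  With \<open>N'\<close> the part of \<open>N\<close> prime to the characteristic and \<open>g = gcd N' m\<close>, a root of
  \<open>(X\<^sup>N\<^sup>' - 1) / (X\<^sup>g - 1) = \<Sum> X\<^sup>g\<^sup>i\<close> works, since this quotient takes the value \<open>N' / g\<close> wherever
  \<open>X\<^sup>g = 1\<close>.
\<close>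

lemma ex_root_of_unity_not_killed:
  assumes N: "N > 0" "\<not> N dvd m"
    and char: "CHAR('k::alg_closed_field) > 0 \<Longrightarrow> \<forall>j. \<not> N dvd m * CHAR('k) ^ j"
  shows "\<exists>l::'k. l ^ N = 1 \<and> l ^ m \<noteq> 1"
proof -
  obtain N' where N': "N' dvd N" "\<not> N' dvd m" "\<not> CHAR('k) dvd N'"
  proof (cases "CHAR('k) = 0")
    case True
    then show ?thesis using that[of N] N by simp
  next
    case False
    then have "Factorial_Ring.prime CHAR('k)" by (intro prime_CHAR_semidom) simp
    then have "\<not> is_unit CHAR('k)" using not_prime_unit by blast
    then obtain N' where N': "N = CHAR('k) ^ multiplicity CHAR('k) N * N'" "\<not> CHAR('k) dvd N'"
      using multiplicity_decompose'[of N "CHAR('k)"] N(1) by blast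
    \<comment> \<open>\<open>N\<close> is \<open>N'\<close> times a power of the characteristic, so
      \<open>N' dvd m\<close> would make \<open>N\<close> divide \<open>m\<close> times that
      power.\<close>
    have "\<not> N' dvd m"
    proof
      assume "N' dvd m"
      then have "N dvd m * CHAR('k) ^ multiplicity CHAR('k) N"
        by (subst N'(1)) (simp add: mult.commute mult_dvd_mono)
      then show False using char False by auto
    qed
    then show ?thesis using that N' by (metis dvd_triv_right)
  qed
  define g where "g = gcd N' m"
  define d where "d = N' div g"
  have N'0: "N' > 0" using N' N(1) by (metis dvd_0_left_iff not_gr0)
  then have g0: "g > 0" by (simp add: g_def)
  have gd: "N' = g * d" by (simp add: d_def g_def)
  have "g \<noteq> N'" using N'(2) by (metis g_def gcd_dvd2)
  then have d1: "d > 1" using gd N'0 by (cases d) (auto simp: neq0_conv)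
  have dk: "of_nat d \<noteq> (0::'k)"
    unfolding of_nat_eq_0_iff_char_dvd using N'(3) gd by (metis dvd_mult)
  define P where "P = (\<Sum>i<d. monom (1::'k) (g * i))"
  \<comment> \<open>The coefficient at the top exponent shows that \<open>P\<close> is not constant
    and so has a root.\<close>
  have "coeff P (g * (d - 1)) = (\<Sum>i<d. if i = d - 1 then 1 else 0)"
    unfolding P_def coeff_sum using g0 by (intro sum.cong) auto
  also have "\<dots> = 1" using d1 by simp
  finally have "degree P \<ge> g * (d - 1)" by (intro le_degree) simp
  moreover have "g * (d - 1) > 0" using g0 d1 by simp
  ultimately have "degree P \<noteq> 0" by linarith
  then obtain l where "poly P l = 0" using alg_closed_imp_poly_has_root by blast
  then have l: "(\<Sum>i<d. (l ^ g) ^ i) = 0"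
    by (simp add: P_def poly_sum poly_monom power_mult)
  have "l ^ g \<noteq> 1" using l dk by auto
  have "(l ^ g) ^ d = 1"
    using power_diff_1_eq[of "l ^ g" d] l by simp
  then have lN': "l ^ N' = 1" by (simp add: gd power_mult)
  have "l ^ m \<noteq> 1"
  proof
    assume lm: "l ^ m = 1"
    \<comment> \<open>By Bezout, \<open>l ^ N' = 1\<close> and \<open>l ^ m = 1\<close> together
      force \<open>l ^ g = 1\<close>.\<close>
    obtain x y where "N' * x = m * y + g"
      using bezout_nat[of N' m] N'0 unfolding g_def by auto
    then have "l ^ (N' * x) = l ^ (m * y) * l ^ g" by (simp add: power_add)
    then have "l ^ g = 1" by (simp add: power_mult lN' lm)
    with \<open>l ^ g \<noteq> 1\<close> show False ..
  qed
  moreover have "l ^ N = 1" using N'(1) lN' by (auto simp: power_mult elim: dvdE)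
  ultimately show ?thesis by blast
qed

section \<open>The \<open>n\<close>-dimensional representation\<close>

text \<open>
  The free algebra acts on sequences \<open>nat \<Rightarrow> 'k\<close> by \<open>(a v) i = l q\<^sup>i v i\<close> and
  \<open>(x v) i = c v (i + 1)\<close>. The sequences of period \<open>n\<close> form an \<open>n\<close>-dimensional submodule, which for
  suitable \<open>l\<close> and \<open>c\<close> is a module over the quotient.
\<close>

context
  fixes q l c :: "'k::field"
begin

primrec act_letters :: "gen list \<Rightarrow> (nat \<Rightarrow> 'k) \<Rightarrow> nat \<Rightarrow> 'k"
  where
    "act_letters [] v = v"
  | "act_letters (g # w) v = (case g of Gen_a \<Rightarrow> \<lambda>i. l * q ^ i * act_letters w v i
      | Gen_x \<Rightarrow> \<lambda>i. c * act_letters w v (Suc i))"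

definition act :: "'k free_alg \<Rightarrow> (nat \<Rightarrow> 'k) \<Rightarrow> nat \<Rightarrow> 'k"
  where "act p v i = lin_ext (\<lambda>w. act_letters (letters w) v i) p"

lemma act_letters_append: "act_letters (w @ w') v = act_letters w (act_letters w' v)"
  by (induction w) (auto split: gen.split)

lemma act_letters_sum:
  "act_letters w (\<lambda>i. \<Sum>j\<in>J. d j * v j i) i = (\<Sum>j\<in>J. d j * act_letters w (v j) i)"
proof (induction w arbitrary: i)
  case (Cons g w)
  then show ?case by (cases g) (simp_all add: sum_distrib_left mult.left_commute)
qed simp

lemma act_sum: "act p (\<lambda>i. \<Sum>j\<in>J. d j * v j i) i = (\<Sum>j\<in>J. d j * act p (v j) i)"
  unfolding act_def act_letters_sum lin_ext_def sum_distrib_left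
  by (subst sum.swap) (simp add: mult.left_commute)

lemma act_add_vec: "act p (\<lambda>i. v i + v' i) i = act p v i + act p v' i"
  using act_sum[of p "\<lambda>_. 1" "\<lambda>b. if b then v else v'" "{True, False}" i] by simp

lemma act_linear:
  "act (p + p') v i = act p v i + act p' v i" "act (p - p') v i = act p v i - act p' v i"
  "act 0 v i = 0"
  by (simp_all add: act_def lin_ext_add lin_ext_diff)

lemma act_single: "act (Poly_Mapping.single w d) v i = d * act_letters (letters w) v i"
  by (simp add: act_def)

lemma act_scal: "act (scal d) v i = d * v i" and act_one: "act 1 v i = v i"
proof -
  show *: "act (scal d) v i = d * v i" for d by (simp add: act_single zero_word_def)
  show "act 1 v i = v i" using *[of 1] by simp
qed

lemma act_mult: "act (p * p') v = act p (act p' v)"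
proof (induction p rule: poly_mapping_linear_induct)
  case (single s d)
  show ?case
  proof (induction p' rule: poly_mapping_linear_induct)
    case (single s' d')
    have "act_letters (letters s) (\<lambda>i. d' * act_letters (letters s') v i) i
        = d' * act_letters (letters s) (act_letters (letters s') v) i" for i
      using act_letters_sum[of "letters s" "\<lambda>_. d'" "\<lambda>_. act_letters (letters s') v" "{()}" i]
      by simp
    then show ?case
      by (simp add: fun_eq_iff act_single mult_single plus_word_def act_letters_append mult.assoc)
  next
    case (add p p')
    have "act (p + p') v = (\<lambda>i. act p v i + act p' v i)"
      by (simp add: fun_eq_iff act_linear)
    then show ?case
      by (intro ext) (simp add: distrib_left act_linear act_add_vec add)
  qed
qed (simp add: distrib_right fun_eq_iff act_linear)

lemma act_gen_a: "act gen_a v i = l * q ^ i * v i"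
  and act_gen_x: "act gen_x v i = c * v (Suc i)"
  by (simp_all add: act_single)

lemma act_gen_a_power: "act (gen_a ^ m) v i = (l * q ^ i) ^ m * v i"
  by (induction m arbitrary: v) (simp_all add: act_one act_mult act_gen_a mult.assoc)

lemma act_gen_x_power: "act (gen_x ^ m) v i = c ^ m * v (i + m)"
  by (induction m arbitrary: i) (simp_all add: act_one act_mult act_gen_x mult.assoc)

text \<open>When the \<open>\<mu> s\<close> are all eigenvalues of \<open>a\<close> but one, this
  product is an unnormalised Lagrange projector onto the remaining eigenline.\<close>

lemma act_prod_list_diagonal:
  "act (prod_list (map (\<lambda>s. gen_a - scal (\<mu> s)) ss)) v i = (\<Prod>s\<leftarrow>ss. l * q ^ i - \<mu> s) * v i"
  by (induction ss) (simp_all add: act_one act_mult act_linear act_gen_a act_scal algebra_simps)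

section \<open>Periodic sequences as a module over the quotient with nonzero
  \<open>\<alpha>\<close>\<close>

context
  fixes n N \<nu> :: nat and \<alpha> :: 'k
  assumes n: "n > 1" and nN: "n dvd N" and q: "primitive_root_of_unity n q"
    and lN: "l ^ N = 1" and N: "N > 0" and \<alpha>: "\<alpha> \<noteq> 0"
    and c: "c \<noteq> 0" "c ^ n = \<alpha> * (l ^ (\<nu> * n) - 1)"
begin

definition periodic :: "(nat \<Rightarrow> 'k) \<Rightarrow> bool"
  where "periodic v \<longleftrightarrow> (\<forall>i. v (i + n) = v i)"

definition unit_vec :: "nat \<Rightarrow> nat \<Rightarrow> 'k"
  where "unit_vec j i = (if i mod n = j then 1 else 0)"

lemma q_power: "q ^ n = 1" "q ^ (n * m) = 1" "q ^ (i + n) = q ^ i"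
  using q by (simp_all add: primitive_root_of_unity_def power_mult power_add)

lemma l_nonzero: "l \<noteq> 0"
  using lN N by (metis power_0_left not_gr0 zero_neq_one)

text \<open>The eigenvalue sequence \<open>l * q ^ i\<close> has period \<open>n\<close> because
  \<open>q ^ n = 1\<close>.\<close>

lemma periodic_act_letters: "periodic v \<Longrightarrow> periodic (act_letters w v)"
proof (induction w)
  case (Cons g w)
  then show ?case
    by (cases g) (simp_all add: periodic_def q_power flip: add_Suc)
qed simp

lemma periodic_act: "periodic v \<Longrightarrow> periodic (act p v)"
  using periodic_act_letters by (simp add: periodic_def act_def)

lemma periodic_unit_vec: "periodic (unit_vec j)"
  by (simp add: periodic_def unit_vec_def)

lemma periodic_expansion:
  assumes "periodic v"
  shows "v = (\<lambda>i. \<Sum>j<n. v j * unit_vec j i)"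
proof
  fix i
  have "v (k + n * m) = v k" for k m
    using assms by (induction m) (simp_all add: periodic_def add.assoc[symmetric] add.commute[of n])
  from this[of "i mod n" "i div n"] have "v i = v (i mod n)" by simp
  also have "\<dots> = (\<Sum>j<n. if j = i mod n then v j else 0)" using n by simp
  also have "\<dots> = (\<Sum>j<n. v j * unit_vec j i)"
    by (intro sum.cong) (auto simp: unit_vec_def)
  finally show "v i = (\<Sum>j<n. v j * unit_vec j i)" .
qed

text \<open>On periodic sequences \<open>x ^ n\<close> acts as the scalar \<open>c ^ n\<close>.
  Since \<open>q ^ n = 1\<close> and \<open>n dvd N\<close>, \<open>a ^ N\<close> and
  \<open>a ^ (\<nu> * n)\<close> act as \<open>l ^ N\<close> and
  \<open>l ^ (\<nu> * n)\<close>.\<close>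

lemma H_relations_act:
  assumes "p \<in> H_relations n q N \<nu> \<alpha>" "periodic v"
  shows "act p v i = 0"
proof -
  obtain m where m: "N = n * m" using nN by auto
  have qi: "q ^ (i * (n * k)) = 1" for k
    using q_power(2)[of "i * k"] by (simp add: mult.left_commute)
  have "(l * q ^ i) ^ N = 1"
    using lN qi[of m] by (simp add: power_mult_distrib m flip: power_mult)
  moreover have "(l * q ^ i) ^ (\<nu> * n) = l ^ (\<nu> * n)"
    using qi[of \<nu>] by (simp add: power_mult_distrib mult.commute[of \<nu> n] flip: power_mult)
  moreover have "v (i + n) = v i" using assms(2) by (simp add: periodic_def)
  moreover consider "p = gen_a ^ N - 1" | "p = gen_x ^ n - scal \<alpha> * (gen_a ^ (\<nu> * n) - 1)"
    | "p = gen_x * gen_a - scal q * gen_a * gen_x"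
    using assms(1) \<alpha> by (auto simp: H_relations_def)
  then show ?thesis
  proof cases
    case 1
    then show ?thesis using calculation(1) by (simp add: act_linear act_one act_gen_a_power)
  next
    case 2
    then show ?thesis
      using calculation(2,3) c(2)
      by (simp add: act_linear act_mult act_one act_scal act_gen_a_power act_gen_x_power left_diff_distrib)
  next
    case 3
    then show ?thesis by (simp add: act_linear act_mult act_scal act_gen_a act_gen_x)
  qed
qed

text \<open>The annihilator of the periodic sequences is a two-sided ideal, the right-hand closure
  coming from \<open>periodic_act\<close>, and it contains the relators.\<close>

lemma H_ideal_act:
  assumes p: "p \<in> H_ideal n q N \<nu> \<alpha>" and v: "periodic v"
  shows "act p v i = 0"
proof -
  interpret R: ring "ring_of_type_algebra :: 'k free_alg ring"
    by (rule ring_ring_of_type_algebra)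
  let ?K = "{p. \<forall>v i. periodic v \<longrightarrow> act p v i = 0}"
  have zero: "act p (\<lambda>_. 0) i = 0" for p i
    using act_sum[of p "\<lambda>_. 0" "\<lambda>_ _. 0" "{}" i] by simp
  have "ideal ?K (ring_of_type_algebra :: 'k free_alg ring)"
  proof (rule idealI[OF ring_ring_of_type_algebra])
    show "subgroup ?K (add_monoid (ring_of_type_algebra :: 'k free_alg ring))"
    proof (rule group.subgroupI[OF R.a_group])
      fix p assume "p \<in> ?K"
      then show "inv\<^bsub>add_monoid ring_of_type_algebra\<^esub> p \<in> ?K"
        using a_inv_ring_of_type_algebra[of p] act_linear(2)[of 0 p]
        by (simp add: a_inv_def act_linear)
    qed (auto simp: act_linear intro: exI[of _ 0])
  next
    fix p p' :: "'k free_alg" assume p: "p \<in> ?K"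
    then have "act p v = (\<lambda>_. 0)" if "periodic v" for v using that by auto
    then show "p' \<otimes>\<^bsub>ring_of_type_algebra\<^esub> p \<in> ?K" by (simp add: act_mult zero)
    show "p \<otimes>\<^bsub>ring_of_type_algebra\<^esub> p' \<in> ?K" using p by (simp add: act_mult periodic_act)
  qed
  moreover have "H_relations n q N \<nu> \<alpha> \<subseteq> ?K" using H_relations_act by blast
  ultimately have "H_ideal n q N \<nu> \<alpha> \<subseteq> ?K"
    unfolding H_ideal_def by (rule R.genideal_minimal)
  then show ?thesis using p v by blast
qed

section \<open>Matrix coefficients on the quotient and preimages of the matrix units\<close>

private abbreviation (input) "Hopf \<equiv> H_hopf n q N \<nu> \<alpha>"
private abbreviation (input) "cls_of \<equiv> H_class n q N \<nu> \<alpha>"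

definition coeff_H :: "nat \<Rightarrow> nat \<Rightarrow> 'k free_alg set \<Rightarrow> 'k"
  where "coeff_H i j = (\<lambda>u\<in>carrier Hopf. the_elem ((\<lambda>p. act p (unit_vec j) i) ` u))"

text \<open>Well-definedness: by \<open>H_ideal_act\<close> all representatives act alike, so
  \<open>the_elem\<close> meets a singleton.\<close>

lemma coeff_H_cls: "coeff_H i j (cls_of p) = act p (unit_vec j) i"
proof -
  have "0 \<in> H_ideal n q N \<nu> \<alpha>"
    using additive_subgroup.zero_closed[OF ideal.axioms(1)[OF ideal_H_ideal]] by auto
  then have "(\<lambda>p. act p (unit_vec j) i) ` cls_of p = {act p (unit_vec j) i}"
    by (auto simp: H_class_eq act_linear H_ideal_act periodic_unit_vec image_image image_constant_conv)
  then show ?thesis by (simp add: coeff_H_def carrier_H)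
qed

lemma coeff_H_dual: "coeff_H i j \<in> dual_carrier Hopf"
  unfolding dual_carrier_def
  by (auto simp: carrier_H add_H smult_H coeff_H_cls act_linear act_mult act_scal)
    (simp add: coeff_H_def carrier_H)

lemma coeff_H_mult:
  assumes "u \<in> carrier Hopf" "v \<in> carrier Hopf"
  shows "coeff_H i j (u \<otimes>\<^bsub>Hopf\<^esub> v) = (\<Sum>m<n. coeff_H i m u * coeff_H m j v)"
proof -
  obtain p p' where p: "u = cls_of p" "v = cls_of p'" using assms by (auto simp: carrier_H)
  \<comment> \<open>Expanding the inner vector in the periodic basis turns composition into matrix
    multiplication.\<close>
  have "act p (act p' (unit_vec j)) i = act p (\<lambda>i. \<Sum>m<n. act p' (unit_vec j) m * unit_vec m i) i"
    by (subst periodic_expansion[OF periodic_act[OF periodic_unit_vec]]) simp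
  also have "\<dots> = (\<Sum>m<n. act p' (unit_vec j) m * act p (unit_vec m) i)"
    by (rule act_sum)
  finally show ?thesis
    by (simp add: p mult_H coeff_H_cls act_mult mult.commute)
qed

text \<open>The value at the eigenvalue \<open>l * q ^ k\<close> of the Lagrange product over the
  other eigenvalues, used for normalisation.\<close>

definition diag :: "nat \<Rightarrow> 'k"
  where "diag k = (\<Prod>s\<leftarrow>filter (\<lambda>s. s \<noteq> k) [0..<n]. l * q ^ k - l * q ^ s)"

text \<open>The power of \<open>x\<close> carries \<open>unit_vec m\<close> to a multiple of
  \<open>unit_vec k\<close>, and the product projects onto coordinate \<open>k\<close>. The exponent
  is \<open>m - k\<close> modulo \<open>n\<close>; the summand \<open>n\<close> avoids truncated
  subtraction.\<close>

definition matrix_unit :: "nat \<Rightarrow> nat \<Rightarrow> 'k free_alg"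
  where "matrix_unit k m = scal (inverse (diag k * c ^ (n - k + m)))
    * (prod_list (map (\<lambda>s. gen_a - scal (l * q ^ s)) (filter (\<lambda>s. s \<noteq> k) [0..<n]))
      * gen_x ^ (n - k + m))"

lemma diag_nonzero:
  assumes "k < n"
  shows "diag k \<noteq> 0"
proof
  assume "diag k = 0"
  then obtain s where "s < n" "s \<noteq> k" "0 = l * q ^ k - l * q ^ s"
    by (auto simp only: diag_def prod_list_zero_iff set_map set_filter set_upt mem_Collect_eq
        atLeastLessThan_iff)
  then show False
    using primitive_root_of_unity_inj[OF q assms, of s] l_nonzero by simp
qed

lemma act_matrix_unit:
  assumes "i < n" "j < n" "k < n" "m < n"
  shows "act (matrix_unit k m) (unit_vec j) i = (if i = k \<and> j = m then 1 else 0)"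
proof -
  have eq: "act (matrix_unit k m) (unit_vec j) i = inverse (diag k * c ^ (n - k + m))
      * ((\<Prod>s\<leftarrow>filter (\<lambda>s. s \<noteq> k) [0..<n]. l * q ^ i - l * q ^ s)
        * (c ^ (n - k + m) * unit_vec j (i + (n - k + m))))"
    by (simp add: matrix_unit_def act_mult act_scal act_prod_list_diagonal act_gen_x_power)
  show ?thesis
  proof (cases "i = k")
    case True
    have cancel: "inverse (A * C) * (A * (C * d)) = d" if "A \<noteq> 0" "C \<noteq> 0" for A C d :: 'k
      using that by (simp add: field_simps)
    have "act (matrix_unit k m) (unit_vec j) k = unit_vec j (k + (n - k + m))"
      unfolding eq[unfolded True] diag_def[symmetric]
      by (rule cancel) (use diag_nonzero[OF assms(3)] c(1) in simp_all)
    \<comment> \<open>The index equals \<open>n + m\<close> because \<open>k < n\<close>, and is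
      congruent to \<open>m\<close> modulo \<open>n\<close>.\<close>
    also have "\<dots> = (if j = m then 1 else 0)"
      using assms by (auto simp: unit_vec_def)
    finally show ?thesis using True by simp
  next
    case False
    \<comment> \<open>The factor for \<open>s = i\<close> makes the Lagrange product vanish.\<close>
    then have "i \<in> set (filter (\<lambda>s. s \<noteq> k) [0..<n])"
      using assms by simp
    then have "0 \<in> (\<lambda>s. l * q ^ i - l * q ^ s) ` set (filter (\<lambda>s. s \<noteq> k) [0..<n])"
      by (rule rev_image_eqI) simp
    then have "(\<Prod>s\<leftarrow>filter (\<lambda>s. s \<noteq> k) [0..<n]. l * q ^ i - l * q ^ s) = 0"
      by (simp only: prod_list_zero_iff set_map)
    then have "act (matrix_unit k m) (unit_vec j) i = 0"
      by (simp only: eq mult_zero_left mult_zero_right)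
    then show ?thesis using False by simp
  qed
qed

lemma simple_subcoalgebra_H:
  "\<not> pointed (dual_hopf Hopf) \<and>
    (\<exists>C. simple_subcoalgebra (dual_hopf Hopf) C \<and> has_dimension (dual_hopf Hopf) C (n ^ 2))"
proof -
  interpret algebra_over_field Hopf by (rule algebra_over_field_H)
  let ?e = "\<lambda>k m. cls_of (matrix_unit k m)"
  have e: "?e k m \<in> carrier Hopf" for k m by (simp add: carrier_H)
  have ce: "coeff_H i j (?e k m) = (if i = k \<and> j = m then 1 else 0)"
    if "i < n" "j < n" "k < n" "m < n" for i j k m
    using act_matrix_unit[OF that] by (simp add: coeff_H_cls)
  note facts = coeff_H_dual coeff_H_mult e ce
  have "\<not> pointed (dual_hopf Hopf)"
    by (rule not_pointed_coeff_space[of n coeff_H ?e]) (use n in \<open>simp_all add: facts\<close>)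
  moreover have "simple_subcoalgebra (dual_hopf Hopf) (coeff_space n coeff_H)"
    by (rule simple_subcoalgebra_coeff_space[of n coeff_H ?e]) (use n in \<open>simp_all add: facts\<close>)
  moreover have "has_dimension (dual_hopf Hopf) (coeff_space n coeff_H) (n ^ 2)"
    by (rule has_dimension_coeff_space[of n coeff_H ?e]) (use n in \<open>simp_all add: facts\<close>)
  ultimately show ?thesis by blast
qed

end

end

text \<open>In characteristic \<open>p > 0\<close>, if \<open>N\<close> divides
  \<open>\<nu> * n * p ^ j\<close>, then \<open>l ^ N = 1\<close> forces
  \<open>l ^ (\<nu> * n) = 1\<close> by injectivity of Frobenius. The assumption on
  \<open>CHAR('k)\<close> excludes exactly this case.\<close>

theorem theorem2p5:
  fixes n \<nu> N :: nat and q \<alpha> :: "'k::alg_closed_field"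
  assumes "n > 0" and "N > 0" and "n dvd N" and "1 \<le> \<nu>" and "\<nu> < N"
    and "primitive_root_of_unity n q"
    and "\<alpha> \<noteq> 0 \<Longrightarrow> coprime n \<nu> \<and> n > 1 \<and> \<not> N dvd \<nu> * n"
    and "\<alpha> \<noteq> 0 \<Longrightarrow> CHAR('k) > 0 \<Longrightarrow> (\<forall>j. \<not> N dvd \<nu> * n * CHAR('k) ^ j)"
  shows "(pointed (dual_hopf (H_hopf n q N \<nu> \<alpha>)) \<longleftrightarrow> \<alpha> = 0) \<and>
    (\<alpha> \<noteq> 0 \<longrightarrow>
      (\<exists>C. simple_subcoalgebra (dual_hopf (H_hopf n q N \<nu> \<alpha>)) C \<and>
           has_dimension (dual_hopf (H_hopf n q N \<nu> \<alpha>)) C (n ^ 2)))"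
proof (cases "\<alpha> = 0")
  case True
  then show ?thesis using pointed_H[OF assms(2)] by simp
next
  case False
  have n: "n > 1" and "\<not> N dvd \<nu> * n" using assms(7)[OF False] by auto
  then obtain l :: 'k where l: "l ^ N = 1" "l ^ (\<nu> * n) \<noteq> 1"
    using ex_root_of_unity_not_killed[OF assms(2), of "\<nu> * n"] assms(8)[OF False] by blast
  \<comment> \<open>This value of \<open>c ^ n\<close> makes \<open>x ^ n\<close> act as its
    relation demands; it is nonzero, so \<open>x\<close> acts as an invertible shift.\<close>
  obtain c where c: "c ^ n = \<alpha> * (l ^ (\<nu> * n) - 1)"
    using nth_root_exists[OF assms(1)] by blast
  have "c \<noteq> 0"
    using c l(2) False assms(1) by (auto simp: power_0_left)
  then show ?thesis
    using simple_subcoalgebra_H[OF n assms(3,6) l(1) assms(2) False _ c] False by blast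
qed

end
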